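(* Let $T>0$ and let $v$ be the (real-valued, $2\pi$-periodic) solution of $$v(t)=v_0+\tfrac12\int_0^t\mathrm{e}^{s\partial_x^3}\,\partial_x\big(\mathrm{e}^{-s\partial_x^3}v(s)\big)^2\,\mathrm{d}s,$$ where $\int_{\mathbb{T}}v_0\,\mathrm{d}x=0$. Assume that $v(t)\in H^3$ for $0\le t\le T$. For a time step $\tau>0$ set $t_n=n\tau$, $v^0=v_0$, and define for $n\ge0$ $$v^{n+1}=v^n+\tfrac16\,\mathrm{e}^{(t_n+\tau)\partial_x^3}\Big(\mathrm{e}^{-(t_n+\tau)\partial_x^3}\partial_x^{-1}v^n\Big)^2-\tfrac16\,\mathrm{e}^{t_n\partial_x^3}\Big(\mathrm{e}^{-t_n\partial_x^3}\partial_x^{-1}v^n\Big)^2 .$$ Then there exists $\tau_0>0$ such that for all $\tau\le\tau_0$ and all $t_n\le T$ we have $$\Vert v(t_n)-v^n\Vert_{H^1}\le c\,\tau ,$$ where $c$ depends on $\sup_{0\le t\le t_n}\Vert v(t)\Vert_{H^3}$ and $t_n$, but can be chosen independently of $\tau$.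
   Context: Functions are real-valued on the torus $\mathbb{T}=[-\pi,\pi]$ with periodic boundary conditions, with Fourier expansion $f(x)=\sum_{k\in\mathbb{Z}}\hat f_k\mathrm{e}^{ikx}$; $H^r=H^r(\mathbb{T})$ is the usual Sobolev space. The operator $\mathrm{e}^{t\partial_x^3}$ is the Fourier multiplier $\hat f_k\mapsto \mathrm{e}^{-itk^3}\hat f_k$. The operator $\partial_x^{-1}$ is defined by $\partial_x^{-1}f(x)=\sum_{k\neq0}(ik)^{-1}\hat f_k\mathrm{e}^{ikx}$ (the zero mode is mapped to $0$). The equation for $v$ is the KdV equation $\partial_tu+\partial_x^3u=\frac12\partial_x(u^2)$ written in the twisted variable $v(t)=\mathrm{e}^{t\partial_x^3}u(t)$; its solution preserves the zero mean. *)

theory Defs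
  imports "HOL-Analysis.Analysis"
begin

text \<open>
  Real-valued functions on the torus are represented by functions on the real line of
  period \<open>2 * pi\<close>; the Fourier coefficients and the Sobolev norms only depend on the class of
  the function modulo null sets.
\<close>

definition fourier_coeff :: "(real \<Rightarrow> real) \<Rightarrow> int \<Rightarrow> complex" where
  "fourier_coeff f k =
     (\<integral>x. complex_of_real (f x) * cis (- (of_int k * x)) \<partial>(lebesgue_on {-pi..pi})) / (2 * pi)"

definition sobolev_space :: "nat \<Rightarrow> (real \<Rightarrow> real) set" where
  "sobolev_space r =
     {f. (\<forall>x. f (x + 2 * pi) = f x) \<and>
         f \<in> borel_measurable (lebesgue_on {-pi..pi}) \<and>
         integrable (lebesgue_on {-pi..pi}) (\<lambda>x. (f x)\<^sup>2) \<and>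
         (\<lambda>k. (1 + (of_int k)\<^sup>2) ^ r * (cmod (fourier_coeff f k))\<^sup>2) summable_on UNIV}"

text \<open>Only meaningful on \<open>sobolev_space r\<close>: the \<open>infsum\<close> of a non-summable family is 0.\<close>

definition sobolev_norm :: "nat \<Rightarrow> (real \<Rightarrow> real) \<Rightarrow> real" where
  "sobolev_norm r f =
     sqrt (\<Sum>\<^sub>\<infinity>k. (1 + (of_int k)\<^sup>2) ^ r * (cmod (fourier_coeff f k))\<^sup>2)"

text \<open>
  The multiplier is evaluated pointwise, so it is the intended operator only where the resulting
  series converges absolutely, for instance if \<open>m\<close> is bounded and \<open>f\<close> is in
  \<open>sobolev_space 1\<close>.  All multipliers below satisfy \<open>m (- k) = cnj (m k)\<close>, hence the sum is real
  for real-valued \<open>f\<close>, and \<open>Re\<close> merely changes the type.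
\<close>

definition fourier_multiplier :: "(int \<Rightarrow> complex) \<Rightarrow> (real \<Rightarrow> real) \<Rightarrow> real \<Rightarrow> real" where
  "fourier_multiplier m f x = Re (\<Sum>\<^sub>\<infinity>k. m k * fourier_coeff f k * cis (of_int k * x))"

text \<open>The operator \<open>exp (t \<partial>\<^sub>x\<^sup>3)\<close>.\<close>

definition airy_group :: "real \<Rightarrow> (real \<Rightarrow> real) \<Rightarrow> real \<Rightarrow> real" where
  "airy_group t = fourier_multiplier (\<lambda>k. cis (- (t * of_int k ^ 3)))"

text \<open>The operator \<open>\<partial>\<^sub>x\<^sup>-\<^sup>1\<close>.\<close>

definition inv_deriv :: "(real \<Rightarrow> real) \<Rightarrow> real \<Rightarrow> real" where
  "inv_deriv = fourier_multiplier (\<lambda>k. if k = 0 then 0 else inverse (\<i> * of_int k))"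

definition kdv_nonlinearity :: "real \<Rightarrow> (real \<Rightarrow> real) \<Rightarrow> real \<Rightarrow> real" where
  "kdv_nonlinearity s w = airy_group s (deriv (\<lambda>x. (airy_group (- s) w x)\<^sup>2))"

text \<open>
  The time integral is taken pointwise in \<open>x\<close>.  For \<open>v\<close> bounded in \<open>H\<^sup>3\<close> the integrand takes
  values in \<open>H\<^sup>2\<close>, which embeds into the continuous functions.
\<close>

definition twisted_kdv_solution ::
  "real \<Rightarrow> (real \<Rightarrow> real) \<Rightarrow> (real \<Rightarrow> real \<Rightarrow> real) \<Rightarrow> bool" where
  "twisted_kdv_solution T v0 v \<longleftrightarrow>
     (\<forall>t\<in>{0..T}. \<forall>x.
        (\<lambda>s. kdv_nonlinearity s (v s) x) integrable_on {0..t} \<and>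
        v t x = v0 x + 1 / 2 * integral {0..t} (\<lambda>s. kdv_nonlinearity s (v s) x))"

primrec kdv_scheme :: "real \<Rightarrow> (real \<Rightarrow> real) \<Rightarrow> nat \<Rightarrow> real \<Rightarrow> real" where
  "kdv_scheme \<tau> v0 0 = v0"
| "kdv_scheme \<tau> v0 (Suc n) =
     (let w = kdv_scheme \<tau> v0 n; t = real n * \<tau> in
      (\<lambda>x. w x
         + 1 / 6 * airy_group (t + \<tau>) (\<lambda>y. (airy_group (- (t + \<tau>)) (inv_deriv w) y)\<^sup>2) x
         - 1 / 6 * airy_group t (\<lambda>y. (airy_group (- t) (inv_deriv w) y)\<^sup>2) x))"

end

theory Submission
  imports Defs
begin

text \<open>
  Since \<open>k\<^sup>3 - (k - l)\<^sup>3 - l\<^sup>3 = 3 k l (k - l)\<close>, the Fourier coefficients of the twisted solution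
  satisfy \<open>v\<^sub>k' = (i k / 2) \<Sum>\<^sub>l exp (-3 i s k l (k - l)) v\<^sub>k\<^sub>-\<^sub>l v\<^sub>l\<close>, and one step of the scheme
  integrates this right-hand side exactly in \<open>s\<close> with both factors \<open>v\<close> frozen at the beginning
  of the step: integrating the phase produces the denominators \<open>l (k - l)\<close> that the scheme
  expresses through \<open>\<partial>\<^sub>x\<^sup>-\<^sup>1\<close>.  Convergence is consistency plus stability for these sequences in the
  weighted \<open>\<ell>\<^sup>2\<close> norms of \<open>H\<^sup>r\<close>.

  Consistency (\<open>scheme_consistency\<close>): freezing replaces \<open>v(s)\<close> by \<open>v(t\<^sub>n)\<close>.  The equation loses one
  derivative, so for \<open>v\<close> in \<open>H\<^sup>3\<close> the difference is \<open>O(\<tau>)\<close> in \<open>H\<^sup>2\<close>; the outer \<open>\<partial>\<^sub>x\<close> loses one more,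
  and after integration the local error is \<open>O(\<tau>\<^sup>2)\<close> in \<open>H\<^sup>1\<close>.

  Stability (\<open>scheme_stability\<close>): with \<open>Q\<close> the bilinear form of the scheme, the error \<open>e = v - w\<close>
  is propagated by \<open>2 Q(v, e) - Q(e, e)\<close>.  Because of the derivative in \<open>Q\<close> this is not
  \<open>O(\<tau>)\<close> in \<open>H\<^sup>1\<close>, and the square of the norm is expanded instead.  Two facts make every term
  \<open>O(\<tau>) \<parallel>e\<parallel>\<^sup>2\<close>.  The integral of the phase over the step is bounded both by \<open>\<tau>\<close> and by the inverse
  frequency; the geometric mean of the two bounds costs \<open>sqrt \<tau>\<close> but absorbs the factor \<open>k\<close>
  (\<open>phase_integral_smoothing\<close>).  Hence \<open>\<parallel>Q(v, e)\<parallel>\<^sup>2\<close> is harmless, and \<open>\<langle>e, Q(e, e)\<rangle>\<close> is harmless as long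
  as \<open>\<parallel>e\<parallel> \<le> sqrt \<tau>\<close>.  In the remaining term \<open>\<langle>e, Q(v, e)\<rangle>\<close> the top-order part cancels when the
  frequencies of the two \<open>e\<close> are exchanged, which is integration by parts in Fourier
  variables (\<open>energy_estimate\<close>).

  A discrete Gronwall argument (\<open>scheme_convergence\<close>) yields \<open>\<parallel>e\<parallel> \<le> c \<tau>\<close>.  The smallness
  \<open>\<parallel>e\<parallel> \<le> sqrt \<tau>\<close> required along the way follows from this bound for small \<open>\<tau>\<close>; only \<open>\<tau>\<^sub>0\<close>, not \<open>c\<close>,
  is affected by that restriction.  The remaining part identifies the coefficients of the given
  functions: those of the scheme by computing with absolutely convergent trigonometric series
  (\<open>kdv_scheme_coefficients\<close>), and those of the solution, whose equation is given pointwise in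
  \<open>x\<close>, by integrating such series termwise in time (\<open>kdv_solution_coefficients\<close>).
\<close>

section \<open>Square-summable families\<close>

definition square_summable :: "('a \<Rightarrow> real) \<Rightarrow> bool" where
  "square_summable x \<longleftrightarrow> (\<lambda>k. (x k)\<^sup>2) summable_on UNIV"

definition l2norm :: "('a \<Rightarrow> real) \<Rightarrow> real" where
  "l2norm x = sqrt (\<Sum>\<^sub>\<infinity>k. (x k)\<^sup>2)"

lemma l2norm_nonneg [simp]: "0 \<le> l2norm x"
  by (simp add: l2norm_def infsum_nonneg)

lemma l2norm_square: "(l2norm x)\<^sup>2 = (\<Sum>\<^sub>\<infinity>k. (x k)\<^sup>2)"
  by (simp add: l2norm_def infsum_nonneg)

lemma square_summableI:
  assumes "\<And>F. finite F \<Longrightarrow> (\<Sum>k\<in>F. (x k)\<^sup>2) \<le> B\<^sup>2" and "0 \<le> B"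
  shows "square_summable x" "l2norm x \<le> B"
proof -
  have s: "(\<lambda>k. (x k)\<^sup>2) summable_on UNIV"
    by (rule nonneg_bdd_above_summable_on) (use assms(1) in \<open>auto intro!: bdd_aboveI2\<close>)
  then show "square_summable x" by (simp add: square_summable_def)
  have "(\<Sum>\<^sub>\<infinity>k. (x k)\<^sup>2) \<le> B\<^sup>2"
    by (rule infsum_le_finite_sums[OF s]) (use assms(1) in auto)
  then show "l2norm x \<le> B"
    using assms(2) by (simp add: l2norm_def real_le_lsqrt)
qed

lemma sum_squares_le_l2norm:
  assumes "square_summable x" "finite F"
  shows "(\<Sum>k\<in>F. (x k)\<^sup>2) \<le> (l2norm x)\<^sup>2"
  unfolding l2norm_square
  by (rule finite_sum_le_infsum) (use assms in \<open>auto simp: square_summable_def\<close>)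

lemma L2_set_le_l2norm:
  assumes "square_summable x" "finite F"
  shows "L2_set x F \<le> l2norm x"
  unfolding L2_set_def
  by (rule real_le_lsqrt) (use sum_squares_le_l2norm[OF assms] in \<open>auto intro: sum_nonneg\<close>)

lemma abs_le_l2norm:
  assumes "square_summable x" shows "\<bar>x k\<bar> \<le> l2norm x"
proof -
  have "(x k)\<^sup>2 \<le> (l2norm x)\<^sup>2" using sum_squares_le_l2norm[OF assms, of "{k}"] by simp
  then show ?thesis by (simp add: abs_le_square_iff[symmetric])
qed

lemma square_summable_mono:
  assumes "square_summable y" "\<And>k. \<bar>x k\<bar> \<le> \<bar>y k\<bar>"
  shows "square_summable x" "l2norm x \<le> l2norm y"
proof -
  have "(\<Sum>k\<in>F. (x k)\<^sup>2) \<le> (l2norm y)\<^sup>2" if "finite F" for F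
  proof -
    have "(\<Sum>k\<in>F. (x k)\<^sup>2) \<le> (\<Sum>k\<in>F. (y k)\<^sup>2)"
      by (intro sum_mono) (use assms(2) in \<open>simp add: abs_le_square_iff\<close>)
    also have "\<dots> \<le> (l2norm y)\<^sup>2" using assms(1) that by (rule sum_squares_le_l2norm)
    finally show ?thesis .
  qed
  from square_summableI[OF this] show "square_summable x" "l2norm x \<le> l2norm y" by auto
qed

lemma square_summable_cmult:
  assumes "square_summable x" "0 \<le> c"
  shows "square_summable (\<lambda>k. c * x k)" "l2norm (\<lambda>k. c * x k) = c * l2norm x"
  using assms
  by (auto simp: square_summable_def l2norm_def power_mult_distrib summable_on_cmult_right
      infsum_cmult_right' real_sqrt_mult)

lemma square_summable_add:
  assumes "square_summable x" "square_summable y"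
  shows "square_summable (\<lambda>k. x k + y k)" "l2norm (\<lambda>k. x k + y k) \<le> l2norm x + l2norm y"
proof -
  have "(\<Sum>k\<in>F. (x k + y k)\<^sup>2) \<le> (l2norm x + l2norm y)\<^sup>2" if F: "finite F" for F
  proof -
    have "L2_set (\<lambda>k. x k + y k) F \<le> L2_set x F + L2_set y F" by (rule L2_set_triangle_ineq)
    also have "\<dots> \<le> l2norm x + l2norm y"
      by (intro add_mono L2_set_le_l2norm assms F)
    finally have "(L2_set (\<lambda>k. x k + y k) F)\<^sup>2 \<le> (l2norm x + l2norm y)\<^sup>2"
      by (intro power_mono) auto
    then show ?thesis by (simp add: L2_set_def sum_nonneg)
  qed
  from square_summableI[OF this] show "square_summable (\<lambda>k. x k + y k)"
    "l2norm (\<lambda>k. x k + y k) \<le> l2norm x + l2norm y" by auto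
qed

lemma Cauchy_Schwarz_infsum:
  assumes "square_summable x" "square_summable y"
  shows "(\<lambda>k. \<bar>x k * y k\<bar>) summable_on UNIV" "(\<Sum>\<^sub>\<infinity>k. \<bar>x k * y k\<bar>) \<le> l2norm x * l2norm y"
proof -
  have fin: "(\<Sum>k\<in>F. \<bar>x k * y k\<bar>) \<le> l2norm x * l2norm y" if F: "finite F" for F
  proof -
    have "(\<Sum>k\<in>F. \<bar>x k * y k\<bar>) \<le> L2_set x F * L2_set y F"
      using L2_set_mult_ineq[of x y F] by (simp add: abs_mult)
    also have "\<dots> \<le> l2norm x * l2norm y"
      by (intro mult_mono L2_set_le_l2norm assms F) auto
    finally show ?thesis .
  qed
  show s: "(\<lambda>k. \<bar>x k * y k\<bar>) summable_on UNIV"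
    by (rule nonneg_bdd_above_summable_on) (use fin in \<open>auto intro!: bdd_aboveI2\<close>)
  show "(\<Sum>\<^sub>\<infinity>k. \<bar>x k * y k\<bar>) \<le> l2norm x * l2norm y"
    by (rule infsum_le_finite_sums[OF s]) (use fin in auto)
qed

section \<open>Convolution\<close>

definition conv :: "(int \<Rightarrow> 'a::real_normed_field) \<Rightarrow> (int \<Rightarrow> 'a) \<Rightarrow> int \<Rightarrow> 'a" where
  "conv x y k = (\<Sum>\<^sub>\<infinity>l. x (k - l) * y l)"

lemma bij_reflect: "bij (\<lambda>l. k - l)" for k :: int
  by (rule bij_betw_byWitness[where f' = "\<lambda>l. k - l"]) auto

lemma conv_commute: "conv x y k = conv y x k"
proof -
  have "conv y x k = (\<Sum>\<^sub>\<infinity>l. y (k - (k - l)) * x (k - l))"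
    unfolding conv_def
    by (rule infsum_reindex_bij_betw[symmetric, OF bij_reflect[of k], of "\<lambda>l. y (k - l) * x l"])
  then show ?thesis by (simp add: conv_def mult.commute)
qed

lemma bij_shear: "bij (\<lambda>(k :: int, l :: int). (k - l, l))"
  by (rule bij_betw_byWitness[where f' = "\<lambda>(k, l). (k + l, l)"]) auto

lemma summable_on_Times_nonneg:
  fixes x :: "'a \<Rightarrow> real" and y :: "'b \<Rightarrow> real"
  assumes "x summable_on UNIV" "y summable_on UNIV" "\<And>k. 0 \<le> x k" "\<And>k. 0 \<le> y k"
  shows "(\<lambda>(k, l). x k * y l) summable_on UNIV" "(\<Sum>\<^sub>\<infinity>(k, l). x k * y l) = infsum x UNIV * infsum y UNIV"
proof -
  have s: "(\<lambda>(k, l). x k * y l) summable_on UNIV \<times> UNIV"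
  proof (rule summable_on_SigmaI)
    show "((\<lambda>l. (\<lambda>(k, l). x k * y l) (k, l)) has_sum x k * infsum y UNIV) UNIV" for k
      using has_sum_cmult_right[OF has_sum_infsum[OF assms(2)]] by simp
    show "(\<lambda>k. x k * infsum y UNIV) summable_on UNIV"
      using assms(1) by (rule summable_on_cmult_left)
  qed (use assms in auto)
  then show "(\<lambda>(k, l). x k * y l) summable_on UNIV" by simp
  show "(\<Sum>\<^sub>\<infinity>(k, l). x k * y l) = infsum x UNIV * infsum y UNIV"
    using infsum_Sigma_banach[OF s] by (simp add: infsum_cmult_right' infsum_cmult_left')
qed

text \<open>The shear \<open>(k, l) \<mapsto> (k - l, l)\<close> turns the double series of a convolution into a product.\<close>

lemma
  fixes x y :: "int \<Rightarrow> real"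
  assumes "x summable_on UNIV" "y summable_on UNIV" "\<And>k. 0 \<le> x k" "\<And>k. 0 \<le> y k"
  shows summable_conv_l1: "(\<lambda>k. conv x y k) summable_on UNIV"
    and infsum_conv: "infsum (conv x y) UNIV = infsum x UNIV * infsum y UNIV"
proof -
  have eq: "(\<lambda>(k, l). x (k - l) * y l) = (\<lambda>p. (\<lambda>(k, l). x k * y l) ((\<lambda>(k, l). (k - l, l)) p))"
    by (auto simp: fun_eq_iff)
  have s: "(\<lambda>(k, l). x (k - l) * y l) summable_on UNIV"
    unfolding eq summable_on_reindex_bij_betw[OF bij_shear]
    by (rule summable_on_Times_nonneg[OF assms])
  then have s': "(\<lambda>(k, l). x (k - l) * y l) summable_on UNIV \<times> UNIV" by simp
  show "(\<lambda>k. conv x y k) summable_on UNIV"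
    using summable_on_Sigma_banach[OF s'] by (simp add: conv_def)
  have "(\<Sum>\<^sub>\<infinity>(k, l). x (k - l) * y l) = infsum x UNIV * infsum y UNIV"
    unfolding eq infsum_reindex_bij_betw[OF bij_shear]
    by (rule summable_on_Times_nonneg[OF assms])
  then show "infsum (conv x y) UNIV = infsum x UNIV * infsum y UNIV"
    using infsum_Sigma_banach[OF s'] by (simp add: conv_def[abs_def])
qed

lemma summable_on_reflect:
  "(\<lambda>l. x (k - l)) summable_on UNIV \<longleftrightarrow> x summable_on UNIV" for k :: int
  by (rule summable_on_reindex_bij_betw[OF bij_reflect])

lemma summable_on_mult_bounded:
  fixes x y :: "'a \<Rightarrow> real"
  assumes "x summable_on UNIV" "\<And>k. 0 \<le> x k" "\<And>k. 0 \<le> y k" "\<And>k. y k \<le> B"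
  shows "(\<lambda>k. x k * y k) summable_on UNIV"
  by (rule summable_on_comparison_test[OF summable_on_cmult_left[OF assms(1), of B]])
    (use assms in \<open>auto intro!: mult_left_mono mult_nonneg_nonneg\<close>)

lemma square_summable_bounded:
  assumes "square_summable y" shows "y k \<le> l2norm y"
  using abs_le_l2norm[OF assms, of k] by linarith

lemma conv_nonneg: "(\<And>k. 0 \<le> x k) \<Longrightarrow> (\<And>k. 0 \<le> y k) \<Longrightarrow> 0 \<le> (conv x y k :: real)"
  unfolding conv_def by (intro infsum_nonneg) auto

text \<open>Young's inequality \<open>\<ell>\<^sup>1 * \<ell>\<^sup>2 \<subseteq> \<ell>\<^sup>2\<close>: Cauchy-Schwarz with respect to the weight \<open>x (k - \<cdot>)\<close>
  bounds \<open>(x * y)\<^sup>2\<close> by \<open>\<parallel>x\<parallel>\<^sub>1 (x * y\<^sup>2)\<close>, and the sum of a convolution is the product of the sums.\<close>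

lemma Young_convolution:
  fixes x y :: "int \<Rightarrow> real"
  assumes x: "x summable_on UNIV" "\<And>k. 0 \<le> x k" and y: "square_summable y" "\<And>k. 0 \<le> y k"
  shows "(\<lambda>l. x (k - l) * y l) summable_on UNIV"
    and "square_summable (conv x y)"
    and "l2norm (conv x y) \<le> infsum x UNIV * l2norm y"
proof -
  show s: "(\<lambda>l. x (k - l) * y l) summable_on UNIV" for k
    by (rule summable_on_mult_bounded[where B = "l2norm y"])
      (use x y square_summable_bounded[OF y(1)] in \<open>auto simp: summable_on_reflect\<close>)
  define X where "X = infsum x UNIV"
  have X0: "0 \<le> X" unfolding X_def using x by (intro infsum_nonneg) auto
  have y2: "(\<lambda>k. (y k)\<^sup>2) summable_on UNIV" using y by (simp add: square_summable_def)
  have s2: "(\<lambda>l. x (k - l) * (y l)\<^sup>2) summable_on UNIV" for k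
    by (rule summable_on_mult_bounded[where B = "(l2norm y)\<^sup>2"])
      (use x y square_summable_bounded[OF y(1)] in \<open>auto simp: summable_on_reflect power_mono\<close>)
  have pt: "(conv x y k)\<^sup>2 \<le> X * conv x (\<lambda>l. (y l)\<^sup>2) k" for k
  proof -
    \<comment> \<open>the weight is split evenly between the two factors of the Cauchy-Schwarz inequality\<close>
    define u where "u l = sqrt (x (k - l))" for l
    define v where "v l = sqrt (x (k - l)) * y l" for l
    have u2: "(u l)\<^sup>2 = x (k - l)" and v2: "(v l)\<^sup>2 = x (k - l) * (y l)\<^sup>2"
      and uv: "\<bar>u l * v l\<bar> = x (k - l) * y l" for l
      using x(2)[of "k - l"] y(2)[of l]
      by (auto simp: u_def v_def power_mult_distrib abs_mult)
    have su: "square_summable u" "square_summable v"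
      using s2[of k] x(1) by (auto simp: square_summable_def u2 v2 summable_on_reflect)
    have "conv x y k \<le> l2norm u * l2norm v"
      using Cauchy_Schwarz_infsum(2)[OF su] by (simp add: uv conv_def)
    then have "(conv x y k)\<^sup>2 \<le> (l2norm u * l2norm v)\<^sup>2"
      using conv_nonneg[of x y k] x y by (intro power_mono) auto
    also have "\<dots> = (\<Sum>\<^sub>\<infinity>l. x (k - l)) * conv x (\<lambda>l. (y l)\<^sup>2) k"
      by (simp add: power_mult_distrib l2norm_square u2 v2 conv_def)
    also have "(\<Sum>\<^sub>\<infinity>l. x (k - l)) = X"
      unfolding X_def by (rule infsum_reindex_bij_betw[OF bij_reflect])
    finally show ?thesis .
  qed
  have fin: "(\<Sum>k\<in>F. (conv x y k)\<^sup>2) \<le> (X * l2norm y)\<^sup>2" if "finite F" for F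
  proof -
    have "(\<Sum>k\<in>F. (conv x y k)\<^sup>2) \<le> (\<Sum>k\<in>F. X * conv x (\<lambda>l. (y l)\<^sup>2) k)"
      by (intro sum_mono pt)
    also have "\<dots> = X * (\<Sum>k\<in>F. conv x (\<lambda>l. (y l)\<^sup>2) k)" by (simp add: sum_distrib_left)
    also have "\<dots> \<le> X * infsum (conv x (\<lambda>l. (y l)\<^sup>2)) UNIV"
      using X0 that x y y2
      by (intro mult_left_mono finite_sum_le_infsum summable_conv_l1 conv_nonneg) auto
    also have "\<dots> = X * (X * (l2norm y)\<^sup>2)"
      using x y y2 by (subst infsum_conv) (auto simp: X_def l2norm_square)
    finally show ?thesis by (simp add: power2_eq_square algebra_simps)
  qed
  from square_summableI[OF fin] X0 show "square_summable (conv x y)"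
    "l2norm (conv x y) \<le> infsum x UNIV * l2norm y" by (auto simp: X_def)
qed

text \<open>Pairing Young's inequality with a third sequence.  All estimates of the energy method
  have this form; \<open>trilinear_bound_right\<close> takes the other one of the convolved factors in \<open>\<ell>\<^sup>1\<close>.\<close>

lemma trilinear_bound:
  fixes x y z :: "int \<Rightarrow> real"
  assumes x: "square_summable x" "\<And>k. 0 \<le> x k" and y: "y summable_on UNIV" "\<And>k. 0 \<le> y k"
    and z: "square_summable z" "\<And>k. 0 \<le> z k"
  shows "(\<lambda>(k, l). x k * (y (k - l) * z l)) summable_on UNIV"
    and "(\<Sum>\<^sub>\<infinity>(k, l). x k * (y (k - l) * z l)) \<le> l2norm x * infsum y UNIV * l2norm z"
proof -
  note Y = Young_convolution[OF y z]
  have c0: "0 \<le> conv y z k" for k using conv_nonneg y z by blast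
  note CS = Cauchy_Schwarz_infsum[OF x(1) Y(2)]
  have ab: "\<bar>x k * conv y z k\<bar> = x k * conv y z k" for k using x c0 by simp
  have s: "(\<lambda>(k, l). x k * (y (k - l) * z l)) summable_on UNIV \<times> UNIV"
  proof (rule summable_on_SigmaI)
    show "((\<lambda>l. (\<lambda>(k, l). x k * (y (k - l) * z l)) (k, l)) has_sum x k * conv y z k) UNIV" for k
      using has_sum_cmult_right[OF has_sum_infsum[OF Y(1)[of k]]] by (simp add: conv_def)
    show "(\<lambda>k. x k * conv y z k) summable_on UNIV" using CS(1) by (simp add: ab)
  qed (use x y z in auto)
  then show "(\<lambda>(k, l). x k * (y (k - l) * z l)) summable_on UNIV" by simp
  have "(\<Sum>\<^sub>\<infinity>(k, l). x k * (y (k - l) * z l)) = (\<Sum>\<^sub>\<infinity>k. x k * conv y z k)"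
    using infsum_Sigma_banach[OF s] by (simp add: conv_def infsum_cmult_right')
  also have "\<dots> \<le> l2norm x * l2norm (conv y z)" using CS(2) by (simp add: ab)
  also have "\<dots> \<le> l2norm x * (infsum y UNIV * l2norm z)"
    by (intro mult_left_mono Y) auto
  finally show "(\<Sum>\<^sub>\<infinity>(k, l). x k * (y (k - l) * z l)) \<le> l2norm x * infsum y UNIV * l2norm z"
    by (simp add: mult.assoc)
qed

section \<open>Weighted sequence spaces\<close>

text \<open>The Japanese bracket \<open>\<langle>k\<rangle>\<close>.\<close>

definition bracket :: "int \<Rightarrow> real" where
  "bracket k = sqrt (1 + (of_int k)\<^sup>2)"

lemma bracket_ge_1 [simp]: "1 \<le> bracket k"
  by (simp add: bracket_def)

lemma bracket_pos [simp]: "0 < bracket k" "0 \<le> bracket k" "bracket k \<noteq> 0"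
  using bracket_ge_1[of k] by linarith+

lemma bracket_square: "(bracket k)\<^sup>2 = 1 + (of_int k)\<^sup>2"
  by (simp add: bracket_def add_nonneg_nonneg)

lemma abs_le_bracket: "\<bar>of_int k\<bar> \<le> bracket k"
  unfolding bracket_def by (rule real_le_rsqrt) simp

lemma bracket_triangle: "bracket k \<le> bracket (k - l) + bracket l"
proof -
  have "(bracket k)\<^sup>2 \<le> (bracket (k - l) + bracket l)\<^sup>2"
  proof -
    have "\<bar>of_int (k - l)\<bar> * \<bar>of_int l\<bar> \<le> bracket (k - l) * bracket l"
      by (intro mult_mono abs_le_bracket) auto
    moreover have "of_int (k - l) * of_int l \<le> \<bar>of_int (k - l) :: real\<bar> * \<bar>of_int l\<bar>"
      by (metis abs_ge_self abs_mult)
    ultimately have "of_int (k - l) * of_int l \<le> bracket (k - l) * bracket l" by linarith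
    moreover have "(of_int k)\<^sup>2 = (of_int (k - l))\<^sup>2 + 2 * (of_int (k - l) * of_int l) + (of_int l :: real)\<^sup>2"
      by (simp add: power2_eq_square algebra_simps)
    ultimately show ?thesis by (simp add: power2_sum bracket_square)
  qed
  then show ?thesis by (simp add: abs_le_square_iff[symmetric] abs_of_nonneg add_nonneg_nonneg)
qed

lemma bracket_power_triangle:
  "bracket k ^ r \<le> 2 ^ r * (bracket (k - l) ^ r + bracket l ^ r)"
proof -
  define m where "m = max (bracket (k - l)) (bracket l)"
  have "bracket k ^ r \<le> (2 * m) ^ r"
    using bracket_triangle[of k l] by (intro power_mono) (auto simp: m_def)
  also have "\<dots> = 2 ^ r * m ^ r" by (simp add: power_mult_distrib)
  also have "m ^ r \<le> bracket (k - l) ^ r + bracket l ^ r"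
    by (auto simp: m_def max_def)
  finally show ?thesis by simp
qed

text \<open>The constant of the embedding of \<open>H\<^sup>1\<close> into the Wiener algebra.\<close>

definition kappa :: real where
  "kappa = l2norm (\<lambda>k. inverse (bracket k))"

lemma kappa_nonneg [simp]: "0 \<le> kappa" by (simp add: kappa_def)

lemma square_summable_inverse_bracket: "square_summable (\<lambda>k. inverse (bracket k))"
proof -
  have "(\<lambda>k. inverse (1 + (of_int k)\<^sup>2) :: real) summable_on UNIV"
  proof -
    have "summable (\<lambda>n. inverse (1 + (real n)\<^sup>2))"
    proof (rule summable_comparison_test')
      show "summable (\<lambda>n. inverse (real n ^ 2))" by (rule inverse_power_summable) simp
      show "norm (inverse (1 + (real n)\<^sup>2)) \<le> inverse (real n ^ 2)" if "n \<ge> 1" for n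
        using that by (auto simp: add_nonneg_nonneg intro!: le_imp_inverse_le)
    qed
    then have "(\<lambda>n. inverse (1 + (real n)\<^sup>2)) summable_on UNIV"
      by (rule summable_nonneg_imp_summable_on) (simp add: add_nonneg_nonneg)
    then have n: "((\<lambda>k. inverse (1 + (of_int k)\<^sup>2) :: real) \<circ> int) summable_on UNIV"
      "((\<lambda>k. inverse (1 + (of_int k)\<^sup>2) :: real) \<circ> (\<lambda>n. - int n)) summable_on UNIV"
      by (simp_all add: o_def)
    have "(\<lambda>k. inverse (1 + (of_int k)\<^sup>2) :: real) summable_on (range int)"
      "(\<lambda>k. inverse (1 + (of_int k)\<^sup>2) :: real) summable_on (range (\<lambda>n. - int n))"
      using n by (subst summable_on_reindex; simp add: inj_def)+
    then have "(\<lambda>k. inverse (1 + (of_int k)\<^sup>2) :: real) summable_on (range int \<union> range (\<lambda>n. - int n))"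
      by (rule summable_on_union)
    also have "range int \<union> range (\<lambda>n. - int n) = UNIV"
      by (auto intro: int_cases2)
    finally show ?thesis .
  qed
  then show ?thesis by (simp add: square_summable_def power_inverse bracket_square)
qed

definition in_H :: "nat \<Rightarrow> (int \<Rightarrow> 'a::real_normed_vector) \<Rightarrow> bool" where
  "in_H r a \<longleftrightarrow> square_summable (\<lambda>k. bracket k ^ r * norm (a k))"

definition hnorm :: "nat \<Rightarrow> (int \<Rightarrow> 'a::real_normed_vector) \<Rightarrow> real" where
  "hnorm r a = l2norm (\<lambda>k. bracket k ^ r * norm (a k))"

lemma hnorm_nonneg [simp]: "0 \<le> hnorm r a" by (simp add: hnorm_def)

lemma hnorm_norm [simp]: "hnorm r (\<lambda>k. norm (a k)) = hnorm r a"
  and in_H_norm [simp]: "in_H r (\<lambda>k. norm (a k)) \<longleftrightarrow> in_H r a"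
  by (simp_all add: hnorm_def in_H_def)

lemma
  fixes a :: "int \<Rightarrow> 'a::real_normed_vector" and b :: "int \<Rightarrow> 'b::real_normed_vector"
  assumes "in_H s b" "\<And>k. bracket k ^ r * norm (a k) \<le> C * (bracket k ^ s * norm (b k))" "0 \<le> C"
  shows in_H_dominated: "in_H r a" and hnorm_dominated: "hnorm r a \<le> C * hnorm s b"
proof -
  note b = assms(1)[unfolded in_H_def]
  have *: "\<bar>bracket k ^ r * norm (a k)\<bar> \<le> \<bar>C * (bracket k ^ s * norm (b k))\<bar>" for k
    using assms(2)[of k] by (simp add: abs_mult assms(3))
  show "in_H r a" "hnorm r a \<le> C * hnorm s b"
    unfolding in_H_def hnorm_def
    using square_summable_mono[OF square_summable_cmult(1)[OF b assms(3)] *]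
      square_summable_cmult(2)[OF b assms(3)] by auto
qed

lemma
  fixes a :: "int \<Rightarrow> 'a::real_normed_vector"
  assumes "in_H s a" "r \<le> s"
  shows in_H_le: "in_H r a" and hnorm_le: "hnorm r a \<le> hnorm s a"
proof -
  have *: "bracket k ^ r * norm (a k) \<le> 1 * (bracket k ^ s * norm (a k))" for k
    using assms(2) by (simp add: mult_right_mono power_increasing)
  show "in_H r a" "hnorm r a \<le> hnorm s a"
    using in_H_dominated[OF assms(1) *] hnorm_dominated[OF assms(1) *] by simp_all
qed

lemma
  fixes a b :: "int \<Rightarrow> 'a::real_normed_vector"
  assumes "in_H r a" "in_H r b"
  shows in_H_add: "in_H r (\<lambda>k. a k + b k)"
    and hnorm_triangle: "hnorm r (\<lambda>k. a k + b k) \<le> hnorm r a + hnorm r b"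
proof -
  note S = square_summable_add[OF assms[unfolded in_H_def]]
  have *: "\<bar>bracket k ^ r * norm (a k + b k)\<bar> \<le> \<bar>bracket k ^ r * norm (a k) + bracket k ^ r * norm (b k)\<bar>" for k
    by (simp add: abs_mult flip: distrib_left) (simp add: mult_left_mono norm_triangle_ineq)
  show "in_H r (\<lambda>k. a k + b k)" "hnorm r (\<lambda>k. a k + b k) \<le> hnorm r a + hnorm r b"
    using square_summable_mono[OF S(1) *] S(2) by (auto simp: in_H_def hnorm_def)
qed

lemma
  fixes a :: "int \<Rightarrow> 'a::real_normed_vector"
  shows in_H_uminus [simp]: "in_H r (\<lambda>k. - a k) \<longleftrightarrow> in_H r a"
    and hnorm_uminus [simp]: "hnorm r (\<lambda>k. - a k) = hnorm r a"
  by (simp_all add: in_H_def hnorm_def)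

lemma
  fixes a :: "int \<Rightarrow> 'a::real_normed_vector"
  assumes "in_H r a"
  shows norm_le_hnorm: "bracket k ^ r * norm (a k) \<le> hnorm r a"
  using abs_le_l2norm[OF assms[unfolded in_H_def], of k] by (simp add: hnorm_def abs_mult)

text \<open>One power of the bracket buys summability, because its inverse is square summable.\<close>

lemma
  fixes a :: "int \<Rightarrow> 'a::real_normed_vector"
  assumes "in_H (Suc r) a"
  shows H1_summable: "(\<lambda>k. bracket k ^ r * norm (a k)) summable_on UNIV"
    and H1_infsum: "(\<Sum>\<^sub>\<infinity>k. bracket k ^ r * norm (a k)) \<le> kappa * hnorm (Suc r) a"
proof -
  have *: "\<bar>inverse (bracket k) * (bracket k ^ Suc r * norm (a k))\<bar> = bracket k ^ r * norm (a k)" for k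
    by (simp add: abs_mult field_simps)
  show "(\<lambda>k. bracket k ^ r * norm (a k)) summable_on UNIV"
    "(\<Sum>\<^sub>\<infinity>k. bracket k ^ r * norm (a k)) \<le> kappa * hnorm (Suc r) a"
    using Cauchy_Schwarz_infsum[OF square_summable_inverse_bracket assms[unfolded in_H_def], unfolded *]
    by (simp_all only: kappa_def hnorm_def)
qed

lemma H1_abs_summable:
  fixes a :: "int \<Rightarrow> 'a::real_normed_vector"
  assumes "in_H (Suc r) a"
  shows "(\<lambda>k. norm (a k)) summable_on UNIV" "(\<Sum>\<^sub>\<infinity>k. norm (a k)) \<le> kappa * hnorm (Suc r) a"
proof -
  have 1: "in_H (Suc 0) a" "hnorm (Suc 0) a \<le> hnorm (Suc r) a"
    using in_H_le[OF assms] hnorm_le[OF assms] by auto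
  show "(\<lambda>k. norm (a k)) summable_on UNIV" "(\<Sum>\<^sub>\<infinity>k. norm (a k)) \<le> kappa * hnorm (Suc r) a"
    using H1_summable[OF 1(1)] H1_infsum[OF 1(1)] mult_left_mono[OF 1(2) kappa_nonneg] by auto
qed

text \<open>\<open>H\<^sup>r\<close> is an algebra for \<open>r \<ge> 1\<close>: the weight \<open>\<langle>k\<rangle>\<^sup>r\<close> is dominated by the sum of the weights at
  \<open>k - l\<close> and \<open>l\<close>, so in each of the two resulting terms only one factor carries it, and the
  other one is in \<open>\<ell>\<^sup>1\<close>.  The form for nonnegative sequences is applied to moduli, so that
  oscillating factors of modulus one do not matter.\<close>

lemma H_algebra:
  fixes x y :: "int \<Rightarrow> real"
  assumes x: "in_H (Suc r) x" "\<And>k. 0 \<le> x k" and y: "in_H (Suc r) y" "\<And>k. 0 \<le> y k"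
  shows "(\<lambda>l. x (k - l) * y l) summable_on UNIV"
    and "in_H (Suc r) (conv x y)"
    and "hnorm (Suc r) (conv x y) \<le> 2 ^ (r + 2) * kappa * hnorm (Suc r) x * hnorm (Suc r) y"
proof -
  define W where "W z k = bracket k ^ Suc r * z k" for z :: "int \<Rightarrow> real" and k
  have W: "square_summable (W z)" "l2norm (W z) = hnorm (Suc r) z" "\<And>k. 0 \<le> W z k"
    "z summable_on UNIV" "infsum z UNIV \<le> kappa * hnorm (Suc r) z"
    if "in_H (Suc r) z" "\<And>k. 0 \<le> z k" for z
    using that H1_abs_summable[OF that(1)] by (auto simp: W_def[abs_def] in_H_def hnorm_def)
  note Wx = W[OF x] and Wy = W[OF y]
  note Y1 = Young_convolution[OF Wx(4) x(2) Wy(1,3)] and Y2 = Young_convolution[OF Wy(4) y(2) Wx(1,3)]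
  have sq: "square_summable y" using in_H_le[OF y(1), of 0] y(2) by (simp add: in_H_def)
  show s: "(\<lambda>l. x (k - l) * y l) summable_on UNIV" for k
    using Young_convolution(1)[OF Wx(4) x(2) sq y(2)] .
  have c0: "0 \<le> conv x y k" for k using conv_nonneg x y by blast
  have b: "\<bar>bracket k ^ Suc r * norm (conv x y k)\<bar> \<le> \<bar>2 ^ Suc r * (conv x (W y) k + conv y (W x) k)\<bar>" for k
  proof -
    have sW: "(\<lambda>l. W x (k - l) * y l) summable_on UNIV"
    proof -
      have "(\<lambda>l. (\<lambda>l. y (k - l) * W x l) (k - l)) summable_on UNIV"
        using Y2(1)[of k] by (subst summable_on_reflect)
      then show ?thesis by (simp add: mult.commute)
    qed
    have "bracket k ^ Suc r * conv x y k = (\<Sum>\<^sub>\<infinity>l. bracket k ^ Suc r * (x (k - l) * y l))"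
      by (simp add: conv_def infsum_cmult_right')
    also have "\<dots> \<le> (\<Sum>\<^sub>\<infinity>l. 2 ^ Suc r * (x (k - l) * W y l + W x (k - l) * y l))"
    proof (rule infsum_mono)
      show "bracket k ^ Suc r * (x (k - l) * y l) \<le> 2 ^ Suc r * (x (k - l) * W y l + W x (k - l) * y l)" for l
      proof -
        have "bracket k ^ Suc r * (x (k - l) * y l)
          \<le> (2 ^ Suc r * (bracket (k - l) ^ Suc r + bracket l ^ Suc r)) * (x (k - l) * y l)"
          by (intro mult_right_mono bracket_power_triangle mult_nonneg_nonneg x y)
        then show ?thesis by (simp add: W_def algebra_simps)
      qed
    qed (intro summable_on_cmult_right summable_on_add s sW Y1(1))+
    also have "\<dots> = 2 ^ Suc r * (conv x (W y) k + conv (W x) y k)"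
      using infsum_add[OF Y1(1)[of k] sW] by (simp add: conv_def infsum_cmult_right')
    finally have "bracket k ^ Suc r * conv x y k \<le> 2 ^ Suc r * (conv x (W y) k + conv y (W x) k)"
      by (simp add: conv_commute[of "W x" y])
    moreover have "0 \<le> bracket k ^ Suc r * conv x y k" using c0 by simp
    ultimately show ?thesis using c0[of k] by simp
  qed
  note A = square_summable_add[OF Y1(2) Y2(2)]
  note S = square_summable_mono[OF square_summable_cmult(1)[OF A(1)] b]
  show "in_H (Suc r) (conv x y)" unfolding in_H_def by (rule S(1)) simp
  have "hnorm (Suc r) (conv x y) \<le> 2 ^ Suc r * l2norm (\<lambda>k. conv x (W y) k + conv y (W x) k)"
    unfolding hnorm_def using S(2) square_summable_cmult(2)[OF A(1), of "2 ^ Suc r"] by simp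
  also have "\<dots> \<le> 2 ^ Suc r * (kappa * hnorm (Suc r) x * hnorm (Suc r) y + kappa * hnorm (Suc r) y * hnorm (Suc r) x)"
  proof (intro mult_left_mono order_trans[OF A(2)] add_mono)
    show "l2norm (conv x (W y)) \<le> kappa * hnorm (Suc r) x * hnorm (Suc r) y"
      using order_trans[OF Y1(3) mult_right_mono[OF Wx(5)]] by (simp add: Wy(2))
    show "l2norm (conv y (W x)) \<le> kappa * hnorm (Suc r) y * hnorm (Suc r) x"
      using order_trans[OF Y2(3) mult_right_mono[OF Wy(5)]] by (simp add: Wx(2))
  qed simp
  finally show "hnorm (Suc r) (conv x y) \<le> 2 ^ (r + 2) * kappa * hnorm (Suc r) x * hnorm (Suc r) y"
    by (simp add: algebra_simps)
qed

section \<open>Series and integrals\<close>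

text \<open>Both statements follow from the uniform convergence given by the Weierstrass M-test.\<close>

lemma
  fixes f :: "'a \<Rightarrow> real \<Rightarrow> 'b::banach"
  assumes c: "\<And>k. continuous_on {a..b} (f k)"
    and le: "\<And>k s. s \<in> {a..b} \<Longrightarrow> norm (f k s) \<le> M k" and M: "M summable_on UNIV"
  shows has_integral_infsum:
      "((\<lambda>s. \<Sum>\<^sub>\<infinity>k. f k s) has_integral (\<Sum>\<^sub>\<infinity>k. integral {a..b} (f k))) {a..b}"
    and continuous_on_infsum: "continuous_on {a..b} (\<lambda>s. \<Sum>\<^sub>\<infinity>k. f k s)"
proof -
  let ?F = "finite_subsets_at_top (UNIV :: 'a set)"
  have u: "uniform_limit {a..b} (\<lambda>X s. \<Sum>k\<in>X. f k s) (\<lambda>s. \<Sum>\<^sub>\<infinity>k. f k s) ?F"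
    by (rule Weierstrass_m_test_general[OF le M]) auto
  have c': "continuous_on {a..b} (\<lambda>s. \<Sum>k\<in>X. f k s)" for X
    by (intro continuous_on_sum c)
  obtain I J where IJ: "\<And>X. ((\<lambda>s. \<Sum>k\<in>X. f k s) has_integral I X) {a..b}"
    "((\<lambda>s. \<Sum>\<^sub>\<infinity>k. f k s) has_integral J) {a..b}" "(I \<longlongrightarrow> J) ?F"
    using uniform_limit_integral[OF u c' finite_subsets_at_top_neq_bot] by metis
  have "(I \<longlongrightarrow> J) ?F \<longleftrightarrow> ((\<lambda>X. \<Sum>k\<in>X. integral {a..b} (f k)) \<longlongrightarrow> J) ?F"
  proof (rule tendsto_cong, rule eventually_finite_subsets_at_top_weakI)
    fix X :: "'a set" assume "finite X"
    then have "((\<lambda>s. \<Sum>k\<in>X. f k s) has_integral (\<Sum>k\<in>X. integral {a..b} (f k))) {a..b}"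
      by (intro has_integral_sum integrable_integral integrable_continuous_interval c) auto
    then show "I X = (\<Sum>k\<in>X. integral {a..b} (f k))" using IJ(1) has_integral_unique by blast
  qed
  then have "((\<lambda>k. integral {a..b} (f k)) has_sum J) UNIV" using IJ(3) by (simp add: has_sum_def)
  then show "((\<lambda>s. \<Sum>\<^sub>\<infinity>k. f k s) has_integral (\<Sum>\<^sub>\<infinity>k. integral {a..b} (f k))) {a..b}"
    using IJ(2) infsumI by blast
  show "continuous_on {a..b} (\<lambda>s. \<Sum>\<^sub>\<infinity>k. f k s)"
    by (rule uniform_limit_theorem[OF _ u]) (auto intro: always_eventually c')
qed

text \<open>Minkowski's integral inequality.  Testing the integral with itself on finitely many
  frequencies reduces it to the bound for a scalar integral.\<close>

lemma
  fixes f :: "real \<Rightarrow> int \<Rightarrow> complex"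
  assumes f: "\<And>k. ((\<lambda>s. f s k) has_integral J k) {a..b}" and ab: "a \<le> b"
    and H: "\<And>s. s \<in> {a..b} \<Longrightarrow> in_H r (f s)" "\<And>s. s \<in> {a..b} \<Longrightarrow> hnorm r (f s) \<le> B" and B: "0 \<le> B"
  shows in_H_integral: "in_H r J" and hnorm_integral: "hnorm r J \<le> (b - a) * B"
proof -
  define w where "w k = bracket k ^ r" for k
  have w0: "0 \<le> w k" for k by (simp add: w_def)
  have "(\<Sum>k\<in>F. (w k * norm (J k))\<^sup>2) \<le> ((b - a) * B)\<^sup>2" if F: "finite F" for F
  proof -
    define S where "S = (\<Sum>k\<in>F. (w k * norm (J k))\<^sup>2)"
    have S0: "0 \<le> S" by (simp add: S_def sum_nonneg)
    have "((\<lambda>s. \<Sum>k\<in>F. complex_of_real ((w k)\<^sup>2) * cnj (J k) * f s k) has_integral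
            (\<Sum>k\<in>F. complex_of_real ((w k)\<^sup>2) * cnj (J k) * J k)) {a..b}"
      by (intro has_integral_sum F has_integral_mult_right f)
    moreover have "(\<Sum>k\<in>F. complex_of_real ((w k)\<^sup>2) * cnj (J k) * J k) = of_real S"
      by (simp add: S_def power_mult_distrib complex_norm_square mult_ac del: of_real_power)
    moreover have "norm (\<Sum>k\<in>F. complex_of_real ((w k)\<^sup>2) * cnj (J k) * f s k) \<le> sqrt S * B"
      if "s \<in> {a..b}" for s
    proof -
      have "norm (\<Sum>k\<in>F. complex_of_real ((w k)\<^sup>2) * cnj (J k) * f s k)
        \<le> (\<Sum>k\<in>F. \<bar>w k * norm (J k)\<bar> * \<bar>w k * norm (f s k)\<bar>)"
        by (rule sum_norm_le) (simp add: norm_mult norm_power abs_mult power2_eq_square w0)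
      also have "\<dots> \<le> L2_set (\<lambda>k. w k * norm (J k)) F * L2_set (\<lambda>k. w k * norm (f s k)) F"
        by (rule L2_set_mult_ineq)
      also have "\<dots> \<le> sqrt S * B"
      proof (rule mult_mono)
        show "L2_set (\<lambda>k. w k * norm (J k)) F \<le> sqrt S" by (simp add: L2_set_def S_def)
        have "L2_set (\<lambda>k. w k * norm (f s k)) F \<le> hnorm r (f s)"
          unfolding hnorm_def w_def
          by (rule L2_set_le_l2norm) (use H(1)[OF that] F in \<open>auto simp: in_H_def\<close>)
        then show "L2_set (\<lambda>k. w k * norm (f s k)) F \<le> B" using H(2)[OF that] by linarith
      qed (use S0 in auto)
      finally show ?thesis .
    qed
    ultimately have "norm (complex_of_real S) \<le> sqrt S * B * measure lborel {a..b}"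
      using S0 B by (intro has_integral_bound_real[where f = "\<lambda>s. \<Sum>k\<in>F. complex_of_real ((w k)\<^sup>2) * cnj (J k) * f s k"]) auto
    then have le: "sqrt S * sqrt S \<le> sqrt S * ((b - a) * B)" using ab S0 by (simp add: mult_ac)
    have "sqrt S \<le> (b - a) * B"
    proof (cases "S = 0")
      case False
      then show ?thesis using mult_left_le_imp_le[OF le] S0 by simp
    qed (use ab B in simp)
    then have "(sqrt S)\<^sup>2 \<le> ((b - a) * B)\<^sup>2" using S0 by (intro power_mono) auto
    then show ?thesis using S0 by (simp add: S_def)
  qed
  from square_summableI[OF this] ab B show "in_H r J" "hnorm r J \<le> (b - a) * B"
    by (auto simp: in_H_def hnorm_def w_def)
qed

section \<open>The oscillating bilinear form\<close>

text \<open>The factor left of the three Airy groups in the nonlinearity after cancelling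
  \<open>k\<^sup>3 - (k - l)\<^sup>3 - l\<^sup>3 = 3 k l (k - l)\<close>.\<close>

definition phase :: "real \<Rightarrow> int \<Rightarrow> int \<Rightarrow> complex" where
  "phase s k l = cis (- (3 * s * of_int (k * l * (k - l))))"

lemma norm_phase [simp]: "norm (phase s k l) = 1"
  by (simp add: phase_def)

lemma phase_swap: "phase s l k = cnj (phase s k l)"
  by (simp add: phase_def cis_cnj algebra_simps)

lemma phase_reflect: "phase s k (k - l) = phase s k l"
  by (simp add: phase_def algebra_simps)

lemma phase_minus: "phase s (- k) (- l) = cnj (phase s k l)"
  by (simp add: phase_def cis_cnj algebra_simps)

definition phase_integral :: "real \<Rightarrow> real \<Rightarrow> int \<Rightarrow> int \<Rightarrow> complex" where
  "phase_integral t \<tau> k l = integral {t..t+\<tau>} (\<lambda>s. phase s k l)"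

lemma continuous_on_phase [continuous_intros]: "continuous_on A (\<lambda>s. phase s k l)"
  unfolding phase_def cis_conv_exp by (intro continuous_intros)

lemma has_integral_phase: "((\<lambda>s. phase s k l) has_integral phase_integral t \<tau> k l) {t..t+\<tau>}"
  unfolding phase_integral_def
  by (intro integrable_integral integrable_continuous_interval continuous_intros)

lemma phase_integral_swap: "phase_integral t \<tau> l k = cnj (phase_integral t \<tau> k l)"
  unfolding phase_integral_def phase_swap[of _ l k] by (rule integral_cnj[symmetric])

lemma phase_integral_reflect: "phase_integral t \<tau> k (k - l) = phase_integral t \<tau> k l"
  unfolding phase_integral_def phase_reflect ..

lemma phase_integral_minus: "phase_integral t \<tau> (- k) (- l) = cnj (phase_integral t \<tau> k l)"
  unfolding phase_integral_def phase_minus by (rule integral_cnj[symmetric])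

lemma norm_phase_integral_le:
  assumes "0 \<le> \<tau>" shows "norm (phase_integral t \<tau> k l) \<le> \<tau>"
  using has_integral_bound_real[OF _ finite.emptyI has_integral_phase, of 1 t \<tau> k l] assms by simp

lemma phase_integral_eq:
  assumes "k * l * (k - l) \<noteq> 0" "0 \<le> \<tau>"
  shows "phase_integral t \<tau> k l
    = (phase (t + \<tau>) k l - phase t k l) / (- (3 * \<i> * of_int (k * l * (k - l))))"
proof -
  define x where "x = (of_int (k * l * (k - l)) :: real)"
  have x: "x \<noteq> 0" using assms(1) unfolding x_def by (simp only: of_int_eq_0_iff not_False_eq_True)
  have ph: "phase s k l = exp (- (3 * \<i> * of_real x) * of_real s)" for s
    by (simp add: phase_def cis_conv_exp x_def mult_ac)
  have "((\<lambda>s. phase s k l) has_integral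
      phase (t + \<tau>) k l / (- (3 * \<i> * of_real x)) - phase t k l / (- (3 * \<i> * of_real x))) {t..t+\<tau>}"
  proof (rule fundamental_theorem_of_calculus)
    fix s assume "s \<in> {t..t+\<tau>}"
    have "((\<lambda>z. exp (- (3 * \<i> * of_real x) * z) / (- (3 * \<i> * of_real x))) has_field_derivative
        exp (- (3 * \<i> * of_real x) * of_real s)) (at (of_real s))"
      using x by (auto intro!: derivative_eq_intros)
    from has_vector_derivative_real_field[OF this]
    show "((\<lambda>s. phase s k l / (- (3 * \<i> * of_real x))) has_vector_derivative phase s k l) (at s within {t..t+\<tau>})"
      by (simp add: ph)
  qed (use assms in simp)
  from has_integral_unique[OF has_integral_phase this] show ?thesis
    by (simp only: x_def diff_divide_distrib of_real_of_int_eq)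
qed

lemma norm_phase_integral_le_inverse:
  assumes "k * l * (k - l) \<noteq> 0" "0 \<le> \<tau>"
  shows "norm (phase_integral t \<tau> k l) \<le> 2 / (3 * \<bar>of_int (k * l * (k - l))\<bar>)"
proof -
  have "norm (phase (t + \<tau>) k l - phase t k l) \<le> 2"
    using norm_triangle_ineq4[of "phase (t + \<tau>) k l" "phase t k l"] by simp
  then show ?thesis
    unfolding phase_integral_eq[OF assms] norm_divide norm_minus_cancel norm_mult norm_of_int
    by (simp add: divide_right_mono)
qed

text \<open>The modulus of the phase integral is at most \<open>\<tau>\<close> and at most \<open>2 / (3 |k l (k - l)|)\<close>, hence at
  most the geometric mean of both.  For nonzero \<open>l\<close> and \<open>k - l\<close> one has \<open>|k| \<le> 2 |l| |k - l|\<close>, so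
  half a power of the denominator compensates the derivative \<open>k\<close>.\<close>

lemma phase_integral_smoothing:
  assumes "l \<noteq> 0" "k \<noteq> l" "0 \<le> \<tau>"
  shows "\<bar>of_int k / 2\<bar> * norm (phase_integral t \<tau> k l) \<le> sqrt \<tau>"
proof (cases "k = 0")
  case False
  define p where "p = norm (phase_integral t \<tau> k l)"
  define K L N where "K = \<bar>of_int k :: real\<bar>" and "L = \<bar>of_int l :: real\<bar>" and "N = \<bar>of_int (k - l) :: real\<bar>"
  have K0: "0 < K" and L1: "1 \<le> L" and N1: "1 \<le> N"
    using False assms by (auto simp: K_def L_def N_def simp flip: of_int_abs)
  have "K \<le> L + N" unfolding K_def L_def N_def by (simp flip: of_int_abs)
  moreover have "L + N \<le> 2 * (L * N)"
  proof -
    have "L * 1 \<le> L * N" "1 * N \<le> L * N" using L1 N1 by (intro mult_mono; simp)+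
    then show ?thesis by simp
  qed
  ultimately have KLN: "K \<le> 2 * (L * N)" by simp
  have p1: "p \<le> \<tau>" unfolding p_def by (rule norm_phase_integral_le[OF assms(3)])
  have p2: "p \<le> 2 / (3 * (K * L * N))"
    using norm_phase_integral_le_inverse[of k l \<tau> t] False assms
    by (simp add: p_def K_def L_def N_def abs_mult)
  have p0: "0 \<le> p" by (simp add: p_def)
  have "(K / 2 * p)\<^sup>2 = K\<^sup>2 / 4 * (p * p)" by (simp add: power2_eq_square)
  also have "\<dots> \<le> K\<^sup>2 / 4 * (\<tau> * (2 / (3 * (K * L * N))))"
    using p0 p1 p2 assms by (intro mult_left_mono mult_mono) auto
  also have "\<dots> = \<tau> * (K / (6 * (L * N)))"
    using K0 L1 N1 by (simp add: power2_eq_square field_simps)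
  also have "\<dots> \<le> \<tau> * 1"
    using KLN L1 N1 assms K0 by (intro mult_left_mono) (auto simp: divide_le_eq)
  finally have "K / 2 * p \<le> sqrt \<tau>" by (intro real_le_rsqrt) simp
  then show ?thesis by (simp add: K_def p_def)
qed (use assms in simp)

text \<open>The increment of one step, polarised to a bilinear form; \<open>scheme_increment_eq_phase_difference\<close> relates it
  to the form with \<open>\<partial>\<^sub>x\<^sup>-\<^sup>1\<close>.\<close>

definition scheme_increment ::
  "real \<Rightarrow> real \<Rightarrow> (int \<Rightarrow> complex) \<Rightarrow> (int \<Rightarrow> complex) \<Rightarrow> int \<Rightarrow> complex" where
  "scheme_increment t \<tau> a b k =
     (\<Sum>\<^sub>\<infinity>l. \<i> * of_int k / 2 * phase_integral t \<tau> k l * (a (k - l) * b l))"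

text \<open>The polarised right-hand side \<open>(1/2) exp (s \<partial>\<^sub>x\<^sup>3) \<partial>\<^sub>x (exp (-s \<partial>\<^sub>x\<^sup>3) a \<cdot> exp (-s \<partial>\<^sub>x\<^sup>3) b)\<close> of the twisted
  equation.\<close>

definition kdv_bilinear ::
  "real \<Rightarrow> (int \<Rightarrow> complex) \<Rightarrow> (int \<Rightarrow> complex) \<Rightarrow> int \<Rightarrow> complex" where
  "kdv_bilinear s a b k = \<i> * of_int k / 2 * (\<Sum>\<^sub>\<infinity>l. phase s k l * (a (k - l) * b l))"

lemma scheme_increment_commute: "scheme_increment t \<tau> a b k = scheme_increment t \<tau> b a k"
proof -
  have "scheme_increment t \<tau> b a k
    = (\<Sum>\<^sub>\<infinity>l. \<i> * of_int k / 2 * phase_integral t \<tau> k (k - l) * (b (k - (k - l)) * a (k - l)))"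
    unfolding scheme_increment_def
    by (rule infsum_reindex_bij_betw[symmetric, OF bij_reflect[of k],
        of "\<lambda>l. \<i> * of_int k / 2 * phase_integral t \<tau> k l * (b (k - l) * a l)"])
  then show ?thesis by (simp add: scheme_increment_def phase_integral_reflect mult_ac)
qed

lemma scheme_increment_0 [simp]: "scheme_increment t \<tau> a b 0 = 0"
  by (simp add: scheme_increment_def)

lemma summable_cmod_products:
  fixes a b :: "int \<Rightarrow> complex"
  assumes "in_H (Suc r) a" "in_H (Suc r) b"
  shows "(\<lambda>l. norm (a (k - l)) * norm (b l)) summable_on UNIV"
  using H_algebra(1)[of r "\<lambda>k. norm (a k)" "\<lambda>k. norm (b k)"] assms by simp

text \<open>Smoothing turns the derivative into a factor \<open>sqrt \<tau>\<close>, whence \<open>H\<^sup>1\<close> is mapped to itself.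
  The zero modes are excluded because there the phase does not oscillate.\<close>

lemma
  assumes a: "in_H 1 a" "a 0 = 0" and b: "in_H 1 b" "b 0 = 0" and \<tau>: "0 \<le> \<tau>"
  shows norm_scheme_term_le:
      "norm (\<i> * of_int k / 2 * phase_integral t \<tau> k l * (a (k - l) * b l))
        \<le> sqrt \<tau> * (norm (a (k - l)) * norm (b l))"
    and summable_scheme_increment:
      "(\<lambda>l. \<i> * of_int k / 2 * phase_integral t \<tau> k l * (a (k - l) * b l)) summable_on UNIV"
    and in_H_scheme_increment: "in_H 1 (scheme_increment t \<tau> a b)"
    and hnorm_scheme_increment:
      "hnorm 1 (scheme_increment t \<tau> a b) \<le> sqrt \<tau> * (4 * kappa * hnorm 1 a * hnorm 1 b)"
proof -
  show 1: "norm (\<i> * of_int k / 2 * phase_integral t \<tau> k l * (a (k - l) * b l))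
        \<le> sqrt \<tau> * (norm (a (k - l)) * norm (b l))" for k l
  proof (cases "l = 0 \<or> k = l")
    case False
    have "norm (\<i> * of_int k / 2 * phase_integral t \<tau> k l * (a (k - l) * b l))
      = (\<bar>of_int k / 2\<bar> * norm (phase_integral t \<tau> k l)) * (norm (a (k - l)) * norm (b l))"
      by (simp add: norm_mult norm_divide)
    also have "\<dots> \<le> sqrt \<tau> * (norm (a (k - l)) * norm (b l))"
      using False \<tau> by (intro mult_right_mono phase_integral_smoothing) auto
    finally show ?thesis .
  qed (use a b \<tau> in auto)
  have ab: "(\<lambda>l. norm (a (k - l)) * norm (b l)) summable_on UNIV" for k
    using summable_cmod_products[of 0 a b k] a b by simp
  have s: "(\<lambda>l. norm (\<i> * of_int k / 2 * phase_integral t \<tau> k l * (a (k - l) * b l))) summable_on UNIV" for k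
    by (rule Infinite_Sum.abs_summable_on_comparison_test'[OF summable_on_cmult_right[OF ab]]) (rule 1)
  then show s': "(\<lambda>l. \<i> * of_int k / 2 * phase_integral t \<tau> k l * (a (k - l) * b l)) summable_on UNIV" for k
    by (rule abs_summable_summable)
  have 2: "norm (scheme_increment t \<tau> a b k) \<le> sqrt \<tau> * conv (\<lambda>k. norm (a k)) (\<lambda>k. norm (b k)) k" for k
    unfolding scheme_increment_def conv_def infsum_cmult_right'[symmetric]
    by (rule norm_infsum_le[OF has_sum_infsum[OF s'] has_sum_infsum[OF summable_on_cmult_right[OF ab]]])
      (rule 1)
  have 3: "bracket k ^ 1 * norm (scheme_increment t \<tau> a b k)
    \<le> sqrt \<tau> * (bracket k ^ 1 * norm (conv (\<lambda>k. norm (a k)) (\<lambda>k. norm (b k)) k))" for k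
    using mult_left_mono[OF 2[of k], of "bracket k"]
    by (simp add: conv_nonneg mult_ac)
  have A: "in_H 1 (conv (\<lambda>k. norm (a k)) (\<lambda>k. norm (b k)))"
    "hnorm 1 (conv (\<lambda>k. norm (a k)) (\<lambda>k. norm (b k))) \<le> 4 * kappa * hnorm 1 a * hnorm 1 b"
    using H_algebra(2,3)[of 0 "\<lambda>k. norm (a k)" "\<lambda>k. norm (b k)"] a b by simp_all
  show "in_H 1 (scheme_increment t \<tau> a b)"
    by (rule in_H_dominated[OF A(1) 3]) (use \<tau> in simp)
  show "hnorm 1 (scheme_increment t \<tau> a b) \<le> sqrt \<tau> * (4 * kappa * hnorm 1 a * hnorm 1 b)"
    by (rule order_trans[OF hnorm_dominated[OF A(1) 3] mult_left_mono[OF A(2)]]) (use \<tau> in simp_all)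
qed

text \<open>Without integration in time the form loses the one derivative in front.\<close>

lemma
  assumes a: "in_H (Suc r) a" and b: "in_H (Suc r) b"
  shows summable_kdv_bilinear: "(\<lambda>l. phase s k l * (a (k - l) * b l)) summable_on UNIV"
    and in_H_kdv_bilinear: "in_H r (kdv_bilinear s a b)"
    and hnorm_kdv_bilinear:
      "hnorm r (kdv_bilinear s a b) \<le> 2 ^ Suc r * kappa * hnorm (Suc r) a * hnorm (Suc r) b"
proof -
  note ab = summable_cmod_products[OF a b]
  have s: "(\<lambda>l. norm (phase s k l * (a (k - l) * b l))) summable_on UNIV" for k
    using ab[of k] by (simp add: norm_mult)
  then show s': "(\<lambda>l. phase s k l * (a (k - l) * b l)) summable_on UNIV" for k
    by (rule abs_summable_summable)
  have "norm (\<Sum>\<^sub>\<infinity>l. phase s k l * (a (k - l) * b l)) \<le> conv (\<lambda>k. norm (a k)) (\<lambda>k. norm (b k)) k" for k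
    unfolding conv_def
    by (rule norm_infsum_le[OF has_sum_infsum[OF s'] has_sum_infsum[OF ab]]) (simp add: norm_mult)
  then have 2: "norm (kdv_bilinear s a b k) \<le> bracket k / 2 * conv (\<lambda>k. norm (a k)) (\<lambda>k. norm (b k)) k" for k
    unfolding kdv_bilinear_def norm_mult
    by (intro mult_mono) (use abs_le_bracket[of k] in \<open>auto simp: norm_divide norm_mult\<close>)
  have 3: "bracket k ^ r * norm (kdv_bilinear s a b k)
    \<le> 1 / 2 * (bracket k ^ Suc r * norm (conv (\<lambda>k. norm (a k)) (\<lambda>k. norm (b k)) k))" for k
    using mult_left_mono[OF 2[of k], of "bracket k ^ r"]
    by (simp add: conv_nonneg mult_ac)
  have A: "in_H (Suc r) (conv (\<lambda>k. norm (a k)) (\<lambda>k. norm (b k)))"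
    "hnorm (Suc r) (conv (\<lambda>k. norm (a k)) (\<lambda>k. norm (b k)))
      \<le> 2 ^ (r + 2) * kappa * hnorm (Suc r) a * hnorm (Suc r) b"
    using H_algebra(2,3)[of r "\<lambda>k. norm (a k)" "\<lambda>k. norm (b k)"] a b by simp_all
  show "in_H r (kdv_bilinear s a b)" by (rule in_H_dominated[OF A(1) 3]) simp
  have "hnorm r (kdv_bilinear s a b) \<le> 1 / 2 * (2 ^ (r + 2) * kappa * hnorm (Suc r) a * hnorm (Suc r) b)"
    by (rule order_trans[OF hnorm_dominated[OF A(1) 3] mult_left_mono[OF A(2)]]) simp_all
  then show "hnorm r (kdv_bilinear s a b) \<le> 2 ^ Suc r * kappa * hnorm (Suc r) a * hnorm (Suc r) b"
    by (simp add: mult_ac)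
qed

text \<open>This is the defining idea of the scheme: for frozen arguments its step is the exact time
  integral.\<close>

lemma has_integral_kdv_bilinear:
  assumes "in_H 1 a" "in_H 1 b"
  shows "((\<lambda>s. kdv_bilinear s a b k) has_integral scheme_increment t \<tau> a b k) {t..t+\<tau>}"
proof -
  have "((\<lambda>s. \<Sum>\<^sub>\<infinity>l. phase s k l * (a (k - l) * b l)) has_integral
      (\<Sum>\<^sub>\<infinity>l. integral {t..t+\<tau>} (\<lambda>s. phase s k l * (a (k - l) * b l)))) {t..t+\<tau>}"
    by (rule has_integral_infsum[where M = "\<lambda>l. norm (a (k - l)) * norm (b l)"])
      (use summable_cmod_products[of 0 a b k] assms in \<open>auto simp: norm_mult intro!: continuous_intros\<close>)
  from has_integral_mult_right[OF this, of "\<i> * of_int k / 2"] show ?thesis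
    unfolding kdv_bilinear_def scheme_increment_def phase_integral_def
    by (simp add: infsum_cmult_right'[symmetric] mult.assoc)
qed

section \<open>The energy estimate\<close>

text \<open>The scalar product of \<open>H\<^sup>1\<close>.\<close>

definition hinner :: "(int \<Rightarrow> complex) \<Rightarrow> (int \<Rightarrow> complex) \<Rightarrow> complex" where
  "hinner a b = (\<Sum>\<^sub>\<infinity>k. of_real ((bracket k)\<^sup>2) * cnj (a k) * b k)"

lemma
  assumes "in_H 1 a" "in_H 1 b"
  shows summable_hinner: "(\<lambda>k. of_real ((bracket k)\<^sup>2) * cnj (a k) * b k) summable_on UNIV"
    and norm_hinner_le: "norm (hinner a b) \<le> hnorm 1 a * hnorm 1 b"
proof -
  have eq: "\<bar>(bracket k ^ 1 * norm (a k)) * (bracket k ^ 1 * norm (b k))\<bar>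
    = norm (of_real ((bracket k)\<^sup>2) * cnj (a k) * b k)" for k
    by (simp add: norm_mult norm_power abs_mult power2_eq_square)
  note CS = Cauchy_Schwarz_infsum[OF assms[unfolded in_H_def], unfolded eq]
  show s: "(\<lambda>k. of_real ((bracket k)\<^sup>2) * cnj (a k) * b k) summable_on UNIV"
    using CS(1) by (rule abs_summable_summable)
  show "norm (hinner a b) \<le> hnorm 1 a * hnorm 1 b"
    unfolding hinner_def hnorm_def using norm_infsum_bound[OF CS(1)] CS(2) by linarith
qed

lemma hinner_add:
  assumes "in_H 1 a" "in_H 1 b" "in_H 1 c"
  shows "hinner a (\<lambda>k. b k + c k) = hinner a b + hinner a c"
  unfolding hinner_def
  using infsum_add[OF summable_hinner[OF assms(1,2)] summable_hinner[OF assms(1,3)]]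
  by (simp add: distrib_left)

lemma hinner_uminus: "hinner a (\<lambda>k. - b k) = - hinner a b"
  by (simp add: hinner_def infsum_uminus)

lemma hnorm_add_square:
  assumes a: "in_H 1 a" and b: "in_H 1 b"
  shows "(hnorm 1 (\<lambda>k. a k + b k))\<^sup>2 = (hnorm 1 a)\<^sup>2 + 2 * Re (hinner a b) + (hnorm 1 b)\<^sup>2"
proof -
  have pt: "(bracket k ^ 1 * norm (a k + b k))\<^sup>2 = (bracket k ^ 1 * norm (a k))\<^sup>2
    + (2 * Re (of_real ((bracket k)\<^sup>2) * cnj (a k) * b k) + (bracket k ^ 1 * norm (b k))\<^sup>2)" for k
    unfolding power_mult_distrib cmod_power2 by (simp add: power2_eq_square algebra_simps)
  note s = summable_hinner[OF a b]
  have s': "(\<lambda>k. 2 * Re (of_real ((bracket k)\<^sup>2) * cnj (a k) * b k)) summable_on UNIV"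
    by (intro summable_on_cmult_right summable_on_Re s)
  have sq: "(\<lambda>k. (bracket k ^ 1 * norm (a k))\<^sup>2) summable_on UNIV"
    "(\<lambda>k. (bracket k ^ 1 * norm (b k))\<^sup>2) summable_on UNIV"
    using a b by (simp_all add: in_H_def square_summable_def)
  show ?thesis
    unfolding hnorm_def l2norm_square pt
    by (subst infsum_add[OF sq(1) summable_on_add[OF s' sq(2)]], subst infsum_add[OF s' sq(2)])
      (simp only: infsum_cmult_right' infsum_Re[OF s] hinner_def add.assoc)
qed

text \<open>With \<open>m = k - l\<close> the left-hand side is \<open>m (\<langle>m\<rangle>\<^sup>2 + 3 k l)\<close>: up to three derivatives fall on the
  factor of frequency \<open>m\<close>, but never more than one on each of the other two.\<close>

lemma bracket_commutator:
  "\<bar>of_int k * (bracket k)\<^sup>2 - of_int l * (bracket l)\<^sup>2\<bar>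
    \<le> bracket (k - l) ^ 3 + 3 * bracket (k - l) * bracket k * bracket l"
proof -
  have "of_int k * (bracket k)\<^sup>2 - of_int l * (bracket l)\<^sup>2
    = of_int (k - l) * ((bracket (k - l))\<^sup>2 + 3 * (of_int k * of_int l))"
    unfolding bracket_square by (simp add: power2_eq_square algebra_simps)
  also have "\<bar>\<dots>\<bar> \<le> bracket (k - l) * ((bracket (k - l))\<^sup>2 + 3 * (bracket k * bracket l))"
    unfolding abs_mult
  proof (rule mult_mono)
    have "\<bar>of_int k * of_int l :: real\<bar> \<le> bracket k * bracket l"
      unfolding abs_mult by (intro mult_mono abs_le_bracket) auto
    then show "\<bar>(bracket (k - l))\<^sup>2 + 3 * (of_int k * of_int l)\<bar> \<le> (bracket (k - l))\<^sup>2 + 3 * (bracket k * bracket l)"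
      by (intro order_trans[OF abs_triangle_ineq]) auto
  qed (use abs_le_bracket[of "k - l"] in auto)
  also have "\<dots> = bracket (k - l) ^ 3 + 3 * bracket (k - l) * bracket k * bracket l"
    by (simp add: power2_eq_square power3_eq_cube algebra_simps)
  finally show ?thesis .
qed

text \<open>The coefficients of real-valued functions.\<close>

definition hermitian :: "(int \<Rightarrow> complex) \<Rightarrow> bool" where
  "hermitian a \<longleftrightarrow> (\<forall>k. a (- k) = cnj (a k))"

lemma bij_reflect_snd: "bij (\<lambda>(k :: int, l :: int). (k, k - l))"
  by (rule bij_betw_byWitness[where f' = "\<lambda>(k, l). (k, k - l)"]) auto

lemma trilinear_bound_right:
  fixes x y z :: "int \<Rightarrow> real"
  assumes x: "square_summable x" "\<And>k. 0 \<le> x k" and y: "y summable_on UNIV" "\<And>k. 0 \<le> y k"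
    and z: "square_summable z" "\<And>k. 0 \<le> z k"
  shows "(\<lambda>(k, l). x k * (z (k - l) * y l)) summable_on UNIV"
    and "(\<Sum>\<^sub>\<infinity>(k, l). x k * (z (k - l) * y l)) \<le> l2norm x * infsum y UNIV * l2norm z"
proof -
  have eq: "(\<lambda>(k, l). x k * (z (k - l) * y l))
    = (\<lambda>p. (\<lambda>(k, l). x k * (y (k - l) * z l)) ((\<lambda>(k, l). (k, k - l)) p))"
    by (auto simp: fun_eq_iff)
  show "(\<lambda>(k, l). x k * (z (k - l) * y l)) summable_on UNIV"
    unfolding eq summable_on_reindex_bij_betw[OF bij_reflect_snd] by (rule trilinear_bound[OF assms])
  show "(\<Sum>\<^sub>\<infinity>(k, l). x k * (z (k - l) * y l)) \<le> l2norm x * infsum y UNIV * l2norm z"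
    unfolding eq infsum_reindex_bij_betw[OF bij_reflect_snd] by (rule trilinear_bound[OF assms])
qed

text \<open>The scalar product is a double series over the frequencies \<open>k\<close> and \<open>l\<close> of the two copies of
  \<open>e\<close>.  Exchanging \<open>k\<close> and \<open>l\<close> conjugates both the phase and \<open>v\<^sub>k\<^sub>-\<^sub>l\<close>, so the real part of the series is
  half the sum of the terms weighted by \<open>k \<langle>k\<rangle>\<^sup>2 - l \<langle>l\<rangle>\<^sup>2\<close>, and by \<open>bracket_commutator\<close> this weight
  leaves at most one derivative on each \<open>e\<close>.  The price are three derivatives of \<open>v\<close>.\<close>

lemma energy_estimate:
  assumes v: "in_H 3 v" "hermitian v" "v 0 = 0" and e: "in_H 1 e" "e 0 = 0" and \<tau>: "0 \<le> \<tau>"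
  shows "\<bar>Re (hinner e (scheme_increment t \<tau> v e))\<bar> \<le> \<tau> * (kappa * hnorm 3 v * (hnorm 1 e)\<^sup>2)"
proof -
  let ?V = "\<lambda>k. norm (v k)" and ?E = "\<lambda>k. norm (e k)"
  let ?BV = "\<lambda>k. bracket k * norm (v k)" and ?BE = "\<lambda>k. bracket k * norm (e k)"
    and ?V3 = "\<lambda>k. bracket k ^ 3 * norm (v k)"
  define G where "G k l = of_real ((bracket k)\<^sup>2) * cnj (e k)
      * (\<i> * of_int k / 2 * phase_integral t \<tau> k l * (v (k - l) * e l))" for k l
  have v1: "in_H 1 v" and v2: "in_H 2 v" "hnorm 2 v \<le> hnorm 3 v"
    using in_H_le[OF v(1)] hnorm_le[OF v(1)] by auto
  have sqE: "square_summable ?BE" "square_summable ?E" "l2norm ?BE = hnorm 1 e" "l2norm ?E \<le> hnorm 1 e"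
    using e in_H_le[OF e(1), of 0] hnorm_le[OF e(1), of 0] by (simp_all add: in_H_def hnorm_def)
  have sqV: "square_summable ?V3" "l2norm ?V3 = hnorm 3 v"
    using v by (simp_all add: in_H_def hnorm_def)
  have lV: "?V summable_on UNIV" "?BV summable_on UNIV" "infsum ?BV UNIV \<le> kappa * hnorm 3 v"
    using H1_abs_summable[of 0 v] v1 H1_summable[of 1 v] H1_infsum[of 1 v] v2
      mult_left_mono[OF v2(2) kappa_nonneg] by (simp_all add: numeral_2_eq_2)
  have lE: "?E summable_on UNIV" "infsum ?E UNIV \<le> kappa * hnorm 1 e"
    using H1_abs_summable[of 0 e] e by simp_all
  \<comment> \<open>The rearrangement needs absolute convergence of the original series.  As \<open>e\<close> is only in \<open>H\<^sup>1\<close>,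
    it is obtained from the smoothing of the phase integral.\<close>
  have sG: "(\<lambda>(k, l). norm (G k l)) summable_on UNIV"
  proof (rule summable_on_comparison_test)
    let ?g = "\<lambda>(k, l). sqrt \<tau> * (?BE k * (?BV (k - l) * ?E l) + ?BE k * (?V (k - l) * ?BE l))"
    have "(\<lambda>p. sqrt \<tau> * ((\<lambda>(k, l). ?BE k * (?BV (k - l) * ?E l)) p + (\<lambda>(k, l). ?BE k * (?V (k - l) * ?BE l)) p)) summable_on UNIV"
      by (intro summable_on_cmult_right summable_on_add trilinear_bound(1) sqE lV) auto
    then show "?g summable_on UNIV" by (simp add: case_prod_unfold)
    show "(\<lambda>(k, l). norm (G k l)) p \<le> ?g p" for p
    proof -
      obtain k l where p: "p = (k, l)" by (cases p)
      have "norm (G k l) = (bracket k * ?BE k) * norm (\<i> * of_int k / 2 * phase_integral t \<tau> k l * (v (k - l) * e l))"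
        by (simp add: G_def norm_mult norm_power power2_eq_square)
      also have "\<dots> \<le> (bracket k * ?BE k) * (sqrt \<tau> * (?V (k - l) * ?E l))"
        by (intro mult_left_mono norm_scheme_term_le v1 v e \<tau>) simp
      also have "\<dots> = bracket k * (?BE k * (sqrt \<tau> * (?V (k - l) * ?E l)))" by simp
      also have "\<dots> \<le> (bracket (k - l) + bracket l) * (?BE k * (sqrt \<tau> * (?V (k - l) * ?E l)))"
        using \<tau> by (intro mult_right_mono bracket_triangle) auto
      finally show ?thesis by (simp add: p algebra_simps)
    qed
  qed auto
  have sG': "(\<lambda>(k, l). G k l) summable_on UNIV"
    by (rule abs_summable_summable) (use sG in \<open>simp add: case_prod_unfold\<close>)
  have swap: "(\<lambda>(k, l). G l k) summable_on UNIV" "(\<Sum>\<^sub>\<infinity>(k, l). G l k) = (\<Sum>\<^sub>\<infinity>(k, l). G k l)"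
  proof -
    have eq: "(\<lambda>(k, l). G l k) = (\<lambda>p. (\<lambda>(k, l). G k l) (prod.swap p))" by (auto simp: fun_eq_iff)
    have b: "bij_betw prod.swap (UNIV :: (int \<times> int) set) UNIV" by (rule bij_swap)
    show "(\<lambda>(k, l). G l k) summable_on UNIV" "(\<Sum>\<^sub>\<infinity>(k, l). G l k) = (\<Sum>\<^sub>\<infinity>(k, l). G k l)"
      unfolding eq summable_on_reindex_bij_betw[OF b] infsum_reindex_bij_betw[OF b] using sG' by auto
  qed
  have hin: "hinner e (scheme_increment t \<tau> v e) = (\<Sum>\<^sub>\<infinity>(k, l). G k l)"
  proof -
    have "(\<Sum>\<^sub>\<infinity>(k, l). G k l) = (\<Sum>\<^sub>\<infinity>k. \<Sum>\<^sub>\<infinity>l. G k l)"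
      using infsum_Sigma_banach[of "\<lambda>(k, l). G k l" UNIV "\<lambda>_. UNIV"] sG' by simp
    then show ?thesis
      unfolding hinner_def scheme_increment_def G_def infsum_cmult_right' by simp
  qed
  \<comment> \<open>symmetrisation under the exchange of the two frequencies\<close>
  have twice: "2 * Re (\<Sum>\<^sub>\<infinity>(k, l). G k l) = Re (\<Sum>\<^sub>\<infinity>(k, l). G k l + cnj (G l k))"
  proof -
    have "(\<Sum>\<^sub>\<infinity>(k, l). G k l + cnj (G l k)) = (\<Sum>\<^sub>\<infinity>(k, l). G k l) + (\<Sum>\<^sub>\<infinity>(k, l). cnj (G l k))"
      using infsum_add[OF sG', of "\<lambda>(k, l). cnj (G l k)"] swap(1)
      by (simp add: case_prod_unfold)
    also have "(\<Sum>\<^sub>\<infinity>(k, l). cnj (G l k)) = cnj (\<Sum>\<^sub>\<infinity>(k, l). G l k)"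
      by (simp add: case_prod_unfold)
    finally show ?thesis by (simp add: swap(2))
  qed
  \<comment> \<open>the two terms of the commutator bound\<close>
  define P Q where "P k l = ?E k * (?V3 (k - l) * ?E l)" and "Q k l = ?BE k * (?BV (k - l) * ?BE l)" for k l
  have sP: "(\<lambda>(k, l). P k l) summable_on UNIV"
    "(\<Sum>\<^sub>\<infinity>(k, l). P k l) \<le> l2norm ?E * infsum ?E UNIV * l2norm ?V3"
    unfolding P_def by (rule trilinear_bound_right[OF sqE(2) _ lE(1) _ sqV(1)]; simp)+
  have sQ: "(\<lambda>(k, l). Q k l) summable_on UNIV"
    "(\<Sum>\<^sub>\<infinity>(k, l). Q k l) \<le> l2norm ?BE * infsum ?BV UNIV * l2norm ?BE"
    unfolding Q_def by (rule trilinear_bound[OF sqE(1) _ lV(2) _ sqE(1)]; simp)+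
  have sPQ: "(\<lambda>(k, l). \<tau> / 2 * (P k l + 3 * Q k l)) summable_on UNIV"
    "(\<Sum>\<^sub>\<infinity>(k, l). \<tau> / 2 * (P k l + 3 * Q k l)) = \<tau> / 2 * ((\<Sum>\<^sub>\<infinity>(k, l). P k l) + 3 * (\<Sum>\<^sub>\<infinity>(k, l). Q k l))"
  proof -
    have eq: "(\<lambda>(k, l). \<tau> / 2 * (P k l + 3 * Q k l))
      = (\<lambda>p. \<tau> / 2 * ((\<lambda>(k, l). P k l) p + 3 * (\<lambda>(k, l). Q k l) p))" by auto
    note s3 = summable_on_cmult_right[OF sQ(1), of 3]
    show "(\<lambda>(k, l). \<tau> / 2 * (P k l + 3 * Q k l)) summable_on UNIV"
      unfolding eq by (intro summable_on_cmult_right summable_on_add sP(1) s3)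
    show "(\<Sum>\<^sub>\<infinity>(k, l). \<tau> / 2 * (P k l + 3 * Q k l)) = \<tau> / 2 * ((\<Sum>\<^sub>\<infinity>(k, l). P k l) + 3 * (\<Sum>\<^sub>\<infinity>(k, l). Q k l))"
      unfolding eq by (simp only: infsum_cmult_right' infsum_add[OF sP(1) s3])
  qed
  have pt: "norm (G k l + cnj (G l k)) \<le> \<tau> / 2 * (P k l + 3 * Q k l)" for k l
  proof -
    have vkl: "v (l - k) = cnj (v (k - l))" using v(2)[unfolded hermitian_def] by (metis minus_diff_eq)
    have "G k l + cnj (G l k) = of_real (of_int k * (bracket k)\<^sup>2 - of_int l * (bracket l)\<^sup>2)
      * (\<i> / 2 * phase_integral t \<tau> k l * (cnj (e k) * (v (k - l) * e l)))"
      unfolding G_def vkl phase_integral_swap[of t \<tau> l k] by (simp add: algebra_simps)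
    also have "norm \<dots> = \<bar>of_int k * (bracket k)\<^sup>2 - of_int l * (bracket l)\<^sup>2\<bar>
      * (norm (phase_integral t \<tau> k l) * (?E k * (?V (k - l) * ?E l)) / 2)"
      by (simp only: norm_mult norm_of_real norm_divide complex_mod_cnj) simp
    also have "\<dots> \<le> (bracket (k - l) ^ 3 + 3 * bracket (k - l) * bracket k * bracket l)
      * (\<tau> * (?E k * (?V (k - l) * ?E l)) / 2)"
      by (intro mult_mono bracket_commutator divide_right_mono norm_phase_integral_le \<tau>)
        (auto intro!: add_nonneg_nonneg)
    also have "\<dots> = \<tau> / 2 * (P k l + 3 * Q k l)" by (simp add: P_def Q_def algebra_simps)
    finally show ?thesis .
  qed
  have sH: "(\<lambda>(k, l). G k l + cnj (G l k)) summable_on UNIV"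
    using summable_on_add[OF sG', of "\<lambda>(k, l). cnj (G l k)"] swap(1) by (simp add: case_prod_unfold)
  have "norm (\<Sum>\<^sub>\<infinity>(k, l). G k l + cnj (G l k)) \<le> (\<Sum>\<^sub>\<infinity>(k, l). \<tau> / 2 * (P k l + 3 * Q k l))"
    by (rule norm_infsum_le[OF has_sum_infsum[OF sH] has_sum_infsum[OF sPQ(1)]]) (use pt in auto)
  also have "\<dots> \<le> \<tau> / 2 * (hnorm 1 e * (kappa * hnorm 1 e) * hnorm 3 v
      + 3 * (hnorm 1 e * (kappa * hnorm 3 v) * hnorm 1 e))"
  proof -
    have "l2norm ?E * infsum ?E UNIV * l2norm ?V3 \<le> hnorm 1 e * (kappa * hnorm 1 e) * hnorm 3 v"
      unfolding sqV(2) by (intro mult_mono sqE lE) (auto intro!: infsum_nonneg)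
    moreover have "l2norm ?BE * infsum ?BV UNIV * l2norm ?BE \<le> hnorm 1 e * (kappa * hnorm 3 v) * hnorm 1 e"
      unfolding sqE(3) by (intro mult_mono lV) (auto intro!: infsum_nonneg)
    ultimately have "(\<Sum>\<^sub>\<infinity>(k, l). P k l) + 3 * (\<Sum>\<^sub>\<infinity>(k, l). Q k l)
      \<le> hnorm 1 e * (kappa * hnorm 1 e) * hnorm 3 v + 3 * (hnorm 1 e * (kappa * hnorm 3 v) * hnorm 1 e)"
      using sP(2) sQ(2) by linarith
    then show ?thesis unfolding sPQ(2) using \<tau> by (intro mult_left_mono) simp_all
  qed
  also have "\<dots> = 2 * (\<tau> * (kappa * hnorm 3 v * (hnorm 1 e)\<^sup>2))"
    by (simp add: power2_eq_square algebra_simps)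
  finally have "\<bar>2 * Re (\<Sum>\<^sub>\<infinity>(k, l). G k l)\<bar> \<le> 2 * (\<tau> * (kappa * hnorm 3 v * (hnorm 1 e)\<^sup>2))"
    unfolding twice using abs_Re_le_cmod order_trans by blast
  then show ?thesis by (simp add: hin abs_mult)
qed

section \<open>One step of the scheme\<close>

lemma scheme_increment_add_right:
  assumes "in_H 1 a" "a 0 = 0" "in_H 1 b" "b 0 = 0" "in_H 1 c" "c 0 = 0" "0 \<le> \<tau>"
  shows "scheme_increment t \<tau> a (\<lambda>k. b k + c k) k = scheme_increment t \<tau> a b k + scheme_increment t \<tau> a c k"
  unfolding scheme_increment_def
  by (subst infsum_add[OF summable_scheme_increment[OF assms(1,2,3,4,7)]
        summable_scheme_increment[OF assms(1,2,5,6,7)], symmetric])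
     (simp add: algebra_simps)

lemma scheme_increment_uminus_right:
  "scheme_increment t \<tau> a (\<lambda>k. - b k) k = - scheme_increment t \<tau> a b k"
  unfolding scheme_increment_def by (simp add: infsum_uminus)

lemma scheme_increment_diff:
  assumes v: "in_H 1 v" "v 0 = 0" and e: "in_H 1 e" "e 0 = 0" and \<tau>: "0 \<le> \<tau>"
  shows "scheme_increment t \<tau> v v k
      - scheme_increment t \<tau> (\<lambda>k. v k - e k) (\<lambda>k. v k - e k) k
    = scheme_increment t \<tau> v e k + (scheme_increment t \<tau> v e k + - scheme_increment t \<tau> e e k)"
proof -
  have me: "in_H 1 (\<lambda>k. - e k)" using e by simp
  have w: "in_H 1 (\<lambda>k. v k + - e k)" by (rule in_H_add[OF v(1) me])
  have 1: "scheme_increment t \<tau> (\<lambda>k. v k + - e k) (\<lambda>k. v k + - e k) k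
    = scheme_increment t \<tau> (\<lambda>k. v k + - e k) v k + scheme_increment t \<tau> (\<lambda>k. v k + - e k) (\<lambda>k. - e k) k"
    by (rule scheme_increment_add_right) (use v e w me \<tau> in auto)
  have 2: "scheme_increment t \<tau> a (\<lambda>k. v k + - e k) k = scheme_increment t \<tau> a v k + - scheme_increment t \<tau> a e k"
    if "in_H 1 a" "a 0 = 0" for a
    by (subst scheme_increment_add_right) (use that v e me \<tau> in \<open>auto simp: scheme_increment_uminus_right\<close>)
  note c = scheme_increment_commute[of t \<tau> "\<lambda>k. v k + - e k" v k]
    scheme_increment_commute[of t \<tau> "\<lambda>k. v k + - e k" e k] scheme_increment_commute[of t \<tau> e v k]
  show ?thesis
    using 1 unfolding c scheme_increment_uminus_right 2[OF v] 2[OF e] by simp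
qed

text \<open>The summands come from \<open>\<langle>e, Q(v, e)\<rangle>\<close>, from \<open>\<langle>e, Q(e, e)\<rangle>\<close> and from the square of the increment.\<close>

definition growth_rate :: "real \<Rightarrow> real" where
  "growth_rate M = 4 * kappa * M + 8 * kappa + (4 * kappa * (2 * M + 1))\<^sup>2"

text \<open>Expanding the square of the norm, the term linear in the increment is controlled by the energy
  estimate and the quadratic one by the square of the smoothing factor \<open>sqrt \<tau>\<close>.  The cubic
  term \<open>\<langle>e, Q(e, e)\<rangle>\<close> only gains \<open>sqrt \<tau>\<close>; the other half power is the assumed smallness of \<open>e\<close>.\<close>

lemma scheme_stability:
  assumes v: "in_H 3 v" "hermitian v" "v 0 = 0" "hnorm 3 v \<le> M" and e: "in_H 1 e" "e 0 = 0"
    and \<tau>: "0 \<le> \<tau>" and small: "hnorm 1 e \<le> 1" "hnorm 1 e \<le> sqrt \<tau>"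
  shows "in_H 1 (\<lambda>k. e k + (scheme_increment t \<tau> v v k
            - scheme_increment t \<tau> (\<lambda>k. v k - e k) (\<lambda>k. v k - e k) k))"
    and "hnorm 1 (\<lambda>k. e k + (scheme_increment t \<tau> v v k
            - scheme_increment t \<tau> (\<lambda>k. v k - e k) (\<lambda>k. v k - e k) k))
        \<le> (1 + growth_rate M * \<tau>) * hnorm 1 e"
proof -
  define \<epsilon> where "\<epsilon> = hnorm 1 e"
  have \<epsilon>: "0 \<le> \<epsilon>" "\<epsilon> \<le> 1" "\<epsilon> \<le> sqrt \<tau>" using small by (auto simp: \<epsilon>_def)
  have M: "0 \<le> M" using v(4) hnorm_nonneg order_trans by blast
  have v1: "in_H 1 v" "hnorm 1 v \<le> M" using in_H_le[OF v(1), of 1] hnorm_le[OF v(1), of 1] v(4) by auto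
  define A where "A = scheme_increment t \<tau> v e"
  define B where "B = scheme_increment t \<tau> e e"
  define D where "D k = A k + (A k + - B k)" for k
  have A: "in_H 1 A" "hnorm 1 A \<le> sqrt \<tau> * (4 * kappa * M * \<epsilon>)"
  proof -
    show "in_H 1 A" unfolding A_def by (rule in_H_scheme_increment[OF v1(1) v(3) e \<tau>])
    have "4 * kappa * hnorm 1 v * hnorm 1 e \<le> 4 * kappa * M * \<epsilon>"
      unfolding \<epsilon>_def using v1(2) by (intro mult_right_mono mult_left_mono) auto
    then show "hnorm 1 A \<le> sqrt \<tau> * (4 * kappa * M * \<epsilon>)"
      unfolding A_def
      using order_trans[OF hnorm_scheme_increment[OF v1(1) v(3) e \<tau>] mult_left_mono] \<tau> by simp
  qed
  have B: "in_H 1 B" "hnorm 1 B \<le> sqrt \<tau> * (4 * kappa * \<epsilon> * \<epsilon>)"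
    using in_H_scheme_increment[OF e e \<tau>] hnorm_scheme_increment[OF e e \<tau>] by (auto simp: B_def \<epsilon>_def)
  have B': "in_H 1 (\<lambda>k. - B k)" using B by simp
  have AB: "in_H 1 (\<lambda>k. A k + - B k)" by (rule in_H_add[OF A(1) B'])
  have D: "in_H 1 D" unfolding D_def by (rule in_H_add[OF A(1) AB])
  have eq: "scheme_increment t \<tau> v v k - scheme_increment t \<tau> (\<lambda>k. v k - e k) (\<lambda>k. v k - e k) k = D k" for k
    unfolding D_def A_def B_def by (rule scheme_increment_diff[OF v1(1) v(3) e \<tau>])
  show "in_H 1 (\<lambda>k. e k + (scheme_increment t \<tau> v v k
            - scheme_increment t \<tau> (\<lambda>k. v k - e k) (\<lambda>k. v k - e k) k))"
    unfolding eq by (rule in_H_add[OF e(1) D])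
  have "hnorm 1 D \<le> hnorm 1 A + (hnorm 1 A + hnorm 1 B)"
    unfolding D_def
    using hnorm_triangle[OF A(1) AB] hnorm_triangle[OF A(1) B'] by simp
  also have "\<dots> \<le> sqrt \<tau> * (4 * kappa * M * \<epsilon>) + (sqrt \<tau> * (4 * kappa * M * \<epsilon>) + sqrt \<tau> * (4 * kappa * 1 * \<epsilon>))"
    using \<epsilon> \<tau> by (intro add_mono A order_trans[OF B(2)] mult_left_mono mult_right_mono) auto
  also have "\<dots> = sqrt \<tau> * (4 * kappa * (2 * M + 1) * \<epsilon>)" by (simp add: algebra_simps)
  finally have "(hnorm 1 D)\<^sup>2 \<le> (sqrt \<tau> * (4 * kappa * (2 * M + 1) * \<epsilon>))\<^sup>2"
    by (intro power_mono) auto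
  then have D2: "(hnorm 1 D)\<^sup>2 \<le> \<tau> * (4 * kappa * (2 * M + 1))\<^sup>2 * \<epsilon>\<^sup>2"
    using \<tau> by (simp add: power_mult_distrib mult_ac)
  have "Re (hinner e D) = 2 * Re (hinner e A) - Re (hinner e B)"
    unfolding D_def
    by (subst hinner_add[OF e(1) A(1) AB], subst hinner_add[OF e(1) A(1) B']) (simp add: hinner_uminus)
  also have "\<dots> \<le> 2 * (\<tau> * (kappa * M * \<epsilon>\<^sup>2)) + \<tau> * (4 * kappa * \<epsilon>\<^sup>2)"
  proof -
    have "\<tau> * (kappa * hnorm 3 v * \<epsilon>\<^sup>2) \<le> \<tau> * (kappa * M * \<epsilon>\<^sup>2)"
      using v(4) \<tau> by (intro mult_left_mono mult_right_mono) auto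
    then have 1: "Re (hinner e A) \<le> \<tau> * (kappa * M * \<epsilon>\<^sup>2)"
      using energy_estimate[OF v(1-3) e \<tau>, of t] by (simp add: A_def \<epsilon>_def)
    have "norm (hinner e B) \<le> \<epsilon> * (sqrt \<tau> * (4 * kappa * \<epsilon> * \<epsilon>))"
      using order_trans[OF norm_hinner_le[OF e(1) B(1)] mult_left_mono[OF B(2)]] by (simp add: \<epsilon>_def)
    \<comment> \<open>here one factor \<open>\<epsilon>\<close> is traded for the missing \<open>sqrt \<tau>\<close>\<close>
    also have "\<dots> \<le> sqrt \<tau> * (sqrt \<tau> * (4 * kappa * \<epsilon> * \<epsilon>))"
      using \<epsilon> \<tau> by (intro mult_right_mono) auto
    also have "\<dots> = \<tau> * (4 * kappa * \<epsilon>\<^sup>2)"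
      using \<tau> by (simp add: power2_eq_square mult.assoc[symmetric])
    finally have "- Re (hinner e B) \<le> \<tau> * (4 * kappa * \<epsilon>\<^sup>2)"
      using abs_Re_le_cmod[of "hinner e B"] by linarith
    with 1 show ?thesis by linarith
  qed
  finally have "(hnorm 1 (\<lambda>k. e k + D k))\<^sup>2 \<le> \<epsilon>\<^sup>2 + 2 * (2 * (\<tau> * (kappa * M * \<epsilon>\<^sup>2)) + \<tau> * (4 * kappa * \<epsilon>\<^sup>2))
      + \<tau> * (4 * kappa * (2 * M + 1))\<^sup>2 * \<epsilon>\<^sup>2"
    unfolding hnorm_add_square[OF e(1) D] using D2 by (simp add: \<epsilon>_def)
  also have "\<dots> = (1 + growth_rate M * \<tau>) * \<epsilon>\<^sup>2"
    by (simp add: growth_rate_def algebra_simps)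
  also have "\<dots> \<le> (1 + growth_rate M * \<tau>)\<^sup>2 * \<epsilon>\<^sup>2"
  proof -
    have "0 \<le> growth_rate M * \<tau>" using M \<tau> by (simp add: growth_rate_def)
    then show ?thesis by (intro mult_right_mono self_le_power) auto
  qed
  finally have "(hnorm 1 (\<lambda>k. e k + D k))\<^sup>2 \<le> ((1 + growth_rate M * \<tau>) * \<epsilon>)\<^sup>2"
    by (simp add: power_mult_distrib)
  moreover have "0 \<le> (1 + growth_rate M * \<tau>) * \<epsilon>" using M \<tau> \<epsilon> by (simp add: growth_rate_def)
  ultimately have "hnorm 1 (\<lambda>k. e k + D k) \<le> (1 + growth_rate M * \<tau>) * \<epsilon>"
    by (rule power2_le_imp_le)
  then show "hnorm 1 (\<lambda>k. e k + (scheme_increment t \<tau> v v k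
            - scheme_increment t \<tau> (\<lambda>k. v k - e k) (\<lambda>k. v k - e k) k))
        \<le> (1 + growth_rate M * \<tau>) * hnorm 1 e"
    unfolding eq \<epsilon>_def .
qed

lemma kdv_bilinear_bounds:
  assumes "in_H 3 a" "hnorm 3 a \<le> M"
  shows "in_H 2 (kdv_bilinear s a a)" "hnorm 2 (kdv_bilinear s a a) \<le> 8 * kappa * M\<^sup>2"
proof -
  have M: "0 \<le> M" using assms(2) hnorm_nonneg order_trans by blast
  show "in_H 2 (kdv_bilinear s a a)"
    using in_H_kdv_bilinear[of 2 a a s] assms by simp
  have "hnorm 2 (kdv_bilinear s a a) \<le> 8 * kappa * hnorm 3 a * hnorm 3 a"
    using hnorm_kdv_bilinear[of 2 a a s] assms by simp
  also have "\<dots> \<le> 8 * kappa * M * M"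
    using assms M by (intro mult_mono) auto
  finally show "hnorm 2 (kdv_bilinear s a a) \<le> 8 * kappa * M\<^sup>2"
    by (simp add: power2_eq_square)
qed

lemma kdv_bilinear_diff:
  assumes "in_H 1 a" "in_H 1 b"
  shows "kdv_bilinear s b b k - kdv_bilinear s a a k
    = kdv_bilinear s (\<lambda>k. b k - a k) b k + kdv_bilinear s a (\<lambda>k. b k - a k) k"
proof -
  have d: "in_H 1 (\<lambda>k. b k - a k)" using in_H_add[of 1 b "\<lambda>k. - a k"] assms by simp
  let ?p = "\<lambda>a b l. phase s k l * (a (k - l) * b l)"
  note summ = summable_kdv_bilinear[of 0 _ _ s k, folded One_nat_def]
  have "infsum (?p b b) UNIV = (\<Sum>\<^sub>\<infinity>l. (?p (\<lambda>k. b k - a k) b l + ?p a (\<lambda>k. b k - a k) l) + ?p a a l)"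
    by (simp add: algebra_simps)
  also have "\<dots> = (infsum (?p (\<lambda>k. b k - a k) b) UNIV + infsum (?p a (\<lambda>k. b k - a k)) UNIV) + infsum (?p a a) UNIV"
    using summ[OF d assms(2)] summ[OF assms(1) d] summ[OF assms(1) assms(1)]
    by (subst infsum_add; (intro summable_on_add)?; (subst infsum_add)?; simp)
  finally show ?thesis by (simp add: kdv_bilinear_def algebra_simps)
qed

text \<open>The local error is the time integral of the difference between the form at \<open>v(s)\<close> and at
  \<open>v(t)\<close>.  The length of the interval contributes one factor \<open>\<tau>\<close>, and \<open>v(s) - v(t)\<close>, bounded in
  \<open>H\<^sup>2\<close> by the equation, the other.\<close>

lemma scheme_consistency:
  fixes v :: "real \<Rightarrow> int \<Rightarrow> complex"
  assumes H: "\<And>s. s \<in> {t..t+\<tau>} \<Longrightarrow> in_H 3 (v s)" "\<And>s. s \<in> {t..t+\<tau>} \<Longrightarrow> hnorm 3 (v s) \<le> M"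
    and eq: "\<And>s k. s \<in> {t..t+\<tau>} \<Longrightarrow>
      ((\<lambda>r. kdv_bilinear r (v r) (v r) k) has_integral v s k - v t k) {t..s}"
    and \<tau>: "0 \<le> \<tau>"
  shows "in_H 1 (\<lambda>k. v (t + \<tau>) k - v t k - scheme_increment t \<tau> (v t) (v t) k)"
    and "hnorm 1 (\<lambda>k. v (t + \<tau>) k - v t k - scheme_increment t \<tau> (v t) (v t) k)
      \<le> 64 * kappa\<^sup>2 * M ^ 3 * \<tau>\<^sup>2"
proof -
  have t: "t \<in> {t..t+\<tau>}" "t + \<tau> \<in> {t..t+\<tau>}" using \<tau> by auto
  have M: "0 \<le> M" using H(2)[OF t(1)] hnorm_nonneg order_trans by blast
  note rate = kdv_bilinear_bounds[OF H]
  have d: "in_H 2 (\<lambda>k. v s k - v t k)" "hnorm 2 (\<lambda>k. v s k - v t k) \<le> 8 * kappa * M\<^sup>2 * \<tau>"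
    if s: "s \<in> {t..t+\<tau>}" for s
  proof -
    have r: "r \<in> {t..t+\<tau>}" if "r \<in> {t..s}" for r using that s by auto
    have ts: "t \<le> s" using s by simp
    note I = in_H_integral[OF eq[OF s] ts rate(1)[OF r r] rate(2)[OF r r]]
      hnorm_integral[OF eq[OF s] ts rate(1)[OF r r] rate(2)[OF r r]]
    show "in_H 2 (\<lambda>k. v s k - v t k)" by (rule I(1)) auto
    have "hnorm 2 (\<lambda>k. v s k - v t k) \<le> (s - t) * (8 * kappa * M\<^sup>2)" by (rule I(2)) auto
    also have "\<dots> \<le> \<tau> * (8 * kappa * M\<^sup>2)" using s by (intro mult_right_mono) auto
    finally show "hnorm 2 (\<lambda>k. v s k - v t k) \<le> 8 * kappa * M\<^sup>2 * \<tau>" by (simp add: mult_ac)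
  qed
  define f where "f s k = kdv_bilinear s (v s) (v s) k - kdv_bilinear s (v t) (v t) k" for s k
  have v2: "in_H 2 (v s)" "hnorm 2 (v s) \<le> M" "in_H 1 (v s)" if s: "s \<in> {t..t+\<tau>}" for s
    using in_H_le[OF H(1)[OF s], of 2] in_H_le[OF H(1)[OF s], of 1] hnorm_le[OF H(1)[OF s], of 2] H(2)[OF s] by auto
  have f: "in_H 1 (f s)" "hnorm 1 (f s) \<le> 64 * kappa\<^sup>2 * M ^ 3 * \<tau>" if s: "s \<in> {t..t+\<tau>}" for s
  proof -
    let ?d = "\<lambda>k. v s k - v t k"
    have fs: "f s = (\<lambda>k. kdv_bilinear s ?d (v s) k + kdv_bilinear s (v t) ?d k)"
      unfolding f_def using kdv_bilinear_diff[OF v2(3)[OF t(1)] v2(3)[OF s]] by auto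
    note v2s = v2[OF s] and v2t = v2[OF t(1)] and ds = d[OF s]
    have 1: "in_H 1 (kdv_bilinear s ?d (v s))" "in_H 1 (kdv_bilinear s (v t) ?d)"
      by (rule in_H_kdv_bilinear; use v2s v2t ds in \<open>simp add: numeral_2_eq_2\<close>)+
    have 2: "hnorm 1 (kdv_bilinear s ?d (v s)) \<le> 4 * kappa * hnorm 2 ?d * hnorm 2 (v s)"
      "hnorm 1 (kdv_bilinear s (v t) ?d) \<le> 4 * kappa * hnorm 2 (v t) * hnorm 2 ?d"
      using hnorm_kdv_bilinear[of 1 ?d "v s" s] hnorm_kdv_bilinear[of 1 "v t" ?d s] v2s v2t ds
      by (simp_all add: numeral_2_eq_2)
    show "in_H 1 (f s)" unfolding fs by (rule in_H_add[OF 1])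
    have "hnorm 1 (f s) \<le> 4 * kappa * hnorm 2 ?d * hnorm 2 (v s) + 4 * kappa * hnorm 2 (v t) * hnorm 2 ?d"
      unfolding fs using hnorm_triangle[OF 1] 2 by linarith
    also have "\<dots> \<le> 4 * kappa * (8 * kappa * M\<^sup>2 * \<tau>) * M + 4 * kappa * M * (8 * kappa * M\<^sup>2 * \<tau>)"
      using v2s v2t ds M \<tau> by (intro add_mono mult_mono) auto
    also have "\<dots> = 64 * kappa\<^sup>2 * M ^ 3 * \<tau>"
      by (simp add: power2_eq_square power3_eq_cube algebra_simps)
    finally show "hnorm 1 (f s) \<le> 64 * kappa\<^sup>2 * M ^ 3 * \<tau>" .
  qed
  have I: "((\<lambda>s. f s k) has_integral v (t + \<tau>) k - v t k - scheme_increment t \<tau> (v t) (v t) k) {t..t+\<tau>}" for k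
    unfolding f_def
    by (intro has_integral_diff eq t has_integral_kdv_bilinear v2)
  show "in_H 1 (\<lambda>k. v (t + \<tau>) k - v t k - scheme_increment t \<tau> (v t) (v t) k)"
    by (rule in_H_integral[OF I _ f]) (use M \<tau> in auto)
  have "hnorm 1 (\<lambda>k. v (t + \<tau>) k - v t k - scheme_increment t \<tau> (v t) (v t) k)
    \<le> (t + \<tau> - t) * (64 * kappa\<^sup>2 * M ^ 3 * \<tau>)"
    by (rule hnorm_integral[OF I _ f]) (use M \<tau> in auto)
  then show "hnorm 1 (\<lambda>k. v (t + \<tau>) k - v t k - scheme_increment t \<tau> (v t) (v t) k)
      \<le> 64 * kappa\<^sup>2 * M ^ 3 * \<tau>\<^sup>2"
    by (simp add: power2_eq_square mult_ac)
qed

section \<open>Convergence in sequence space\<close>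

text \<open>The accumulated local errors \<open>64 \<kappa>\<^sup>2 M\<^sup>3 \<tau>\<^sup>2\<close> over \<open>t / \<tau>\<close> steps,
  amplified by Gronwall's factor and divided by \<open>\<tau>\<close>.\<close>

definition error_constant :: "real \<Rightarrow> real \<Rightarrow> real" where
  "error_constant M t = 64 * kappa\<^sup>2 * M ^ 3 * t * exp (growth_rate M * t)"

lemma error_constant_mono:
  assumes "0 \<le> M" "M \<le> M'" "0 \<le> t" "t \<le> t'"
  shows "error_constant M t \<le> error_constant M' t'"
proof -
  have "growth_rate M \<le> growth_rate M'"
    unfolding growth_rate_def using assms by (intro add_mono mult_left_mono power_mono) auto
  moreover have "0 \<le> growth_rate M'" using assms by (simp add: growth_rate_def)
  ultimately have "growth_rate M * t \<le> growth_rate M' * t'" using assms by (intro mult_mono) auto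
  then show ?thesis
    unfolding error_constant_def using assms by (intro mult_mono power_mono) auto
qed

lemma error_constant_nonneg: "0 \<le> M \<Longrightarrow> 0 \<le> t \<Longrightarrow> 0 \<le> error_constant M t"
  by (simp add: error_constant_def)

text \<open>Gronwall's argument, in which the bound itself guarantees the smallness that stability
  demands in the next step.\<close>

lemma scheme_convergence:
  fixes v :: "real \<Rightarrow> int \<Rightarrow> complex" and w :: "nat \<Rightarrow> int \<Rightarrow> complex"
  assumes H: "\<And>s. s \<in> {0..T} \<Longrightarrow> in_H 3 (v s)" "\<And>s. s \<in> {0..T} \<Longrightarrow> hnorm 3 (v s) \<le> M"
    and herm: "\<And>s. s \<in> {0..T} \<Longrightarrow> hermitian (v s)" and mean: "\<And>s. s \<in> {0..T} \<Longrightarrow> v s 0 = 0"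
    and eq: "\<And>r s k. 0 \<le> r \<Longrightarrow> r \<le> s \<Longrightarrow> s \<le> T \<Longrightarrow>
      ((\<lambda>q. kdv_bilinear q (v q) (v q) k) has_integral v s k - v r k) {r..s}"
    and w0: "w 0 = v 0"
    and wSuc: "\<And>n k. w (Suc n) k = w n k + scheme_increment (real n * \<tau>) \<tau> (w n) (w n) k"
    and \<tau>: "0 \<le> \<tau>" and small: "error_constant M T * \<tau> \<le> 1" "error_constant M T * \<tau> \<le> sqrt \<tau>"
    and n: "real n * \<tau> \<le> T"
  shows "in_H 1 (\<lambda>k. v (real n * \<tau>) k - w n k) \<and>
    hnorm 1 (\<lambda>k. v (real n * \<tau>) k - w n k) \<le> error_constant M (real n * \<tau>) * \<tau>"
  using n
proof (induction n)
  case 0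
  have "in_H 1 (\<lambda>k. 0 :: complex)" "hnorm 1 (\<lambda>k. 0 :: complex) = 0"
    by (simp_all add: in_H_def hnorm_def square_summable_def l2norm_def)
  then show ?case by (simp add: w0 error_constant_def)
next
  case (Suc n)
  define t where "t = real n * \<tau>"
  have t: "0 \<le> t" "t + \<tau> \<le> T" "real (Suc n) * \<tau> = t + \<tau>"
    using Suc.prems \<tau> by (auto simp: t_def algebra_simps)
  then have tT: "t \<in> {0..T}" "t \<le> T" using \<tau> by auto
  have M: "0 \<le> M" using H(2)[OF tT(1)] hnorm_nonneg order_trans by blast
  define L where "L = growth_rate M"
  define B where "B = 64 * kappa\<^sup>2 * M ^ 3"
  have L: "0 \<le> L" and B: "0 \<le> B" using M by (auto simp: L_def B_def growth_rate_def)
  define e where "e k = v t k - w n k" for k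
  have IH: "in_H 1 e" "hnorm 1 e \<le> error_constant M t * \<tau>"
    using Suc.IH tT by (auto simp: t_def e_def[abs_def])
  have "error_constant M t * \<tau> \<le> error_constant M T * \<tau>"
    using M t tT \<tau> by (intro mult_right_mono error_constant_mono) auto
  then have e_small: "hnorm 1 e \<le> 1" "hnorm 1 e \<le> sqrt \<tau>" using IH(2) small by linarith+
  have w_mean: "w m 0 = 0" for m
    by (induction m) (use mean[of 0] tT in \<open>auto simp: w0 wSuc\<close>)
  have e0: "e 0 = 0" using mean[OF tT(1)] w_mean by (simp add: e_def)
  have wn: "w n = (\<lambda>k. v t k - e k)" by (simp add: e_def)
  define X where "X k = e k + (scheme_increment t \<tau> (v t) (v t) k
      - scheme_increment t \<tau> (\<lambda>k. v t k - e k) (\<lambda>k. v t k - e k) k)" for k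
  define R where "R k = v (t + \<tau>) k - v t k - scheme_increment t \<tau> (v t) (v t) k" for k
  have X: "in_H 1 X" "hnorm 1 X \<le> (1 + L * \<tau>) * hnorm 1 e"
    unfolding X_def L_def
    by (rule scheme_stability[OF H(1)[OF tT(1)] herm[OF tT(1)] mean[OF tT(1)] H(2)[OF tT(1)] IH(1) e0 \<tau> e_small])+
  have R: "in_H 1 R" "hnorm 1 R \<le> B * \<tau>\<^sup>2"
    unfolding R_def B_def
    by (rule scheme_consistency[where v = v and M = M]; use H eq t \<tau> in auto)+
  have split: "(\<lambda>k. v (real (Suc n) * \<tau>) k - w (Suc n) k) = (\<lambda>k. X k + R k)"
    by (simp only: t(3)) (simp add: X_def R_def wSuc wn fun_eq_iff flip: t_def)
  have "hnorm 1 (\<lambda>k. X k + R k) \<le> (1 + L * \<tau>) * (error_constant M t * \<tau>) + B * \<tau>\<^sup>2"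
    using hnorm_triangle[OF X(1) R(1)] X(2) R(2) mult_left_mono[OF IH(2), of "1 + L * \<tau>"] L \<tau> by simp
  also have "\<dots> \<le> exp (L * \<tau>) * (error_constant M t * \<tau>) + B * \<tau>\<^sup>2 * exp (L * (t + \<tau>))"
  proof (rule add_mono)
    show "(1 + L * \<tau>) * (error_constant M t * \<tau>) \<le> exp (L * \<tau>) * (error_constant M t * \<tau>)"
      using M t \<tau> by (intro mult_right_mono exp_ge_add_one_self mult_nonneg_nonneg error_constant_nonneg)
    have "1 \<le> exp (L * (t + \<tau>))" using L t \<tau> by simp
    then show "B * \<tau>\<^sup>2 \<le> B * \<tau>\<^sup>2 * exp (L * (t + \<tau>))" using mult_left_mono[of 1 "exp (L * (t + \<tau>))" "B * \<tau>\<^sup>2"] B by simp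
  qed
  also have "\<dots> = error_constant M (t + \<tau>) * \<tau>"
    by (simp add: error_constant_def B_def L_def distrib_left exp_add power2_eq_square algebra_simps)
  finally show ?case
    using in_H_add[OF X(1) R(1)] unfolding split unfolding t(3) by simp
qed

section \<open>Trigonometric series\<close>

definition trig_series :: "(int \<Rightarrow> complex) \<Rightarrow> real \<Rightarrow> complex" where
  "trig_series a x = (\<Sum>\<^sub>\<infinity>k. a k * cis (of_int k * x))"

lemma fourier_multiplier_eq:
  "fourier_multiplier m f x = Re (trig_series (\<lambda>k. m k * fourier_coeff f k) x)"
  by (simp add: fourier_multiplier_def trig_series_def)

lemma continuous_on_cis_mult [continuous_intros]: "continuous_on A (\<lambda>x. cis (c * x))"
  unfolding cis_conv_exp by (intro continuous_intros)

lemma bij_minus_int: "bij (\<lambda>k :: int. - k)"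
  by (rule bij_betw_byWitness[where f' = "\<lambda>k. - k"]) auto

lemma infsum_minus_int: "(\<Sum>\<^sub>\<infinity>k::int. f (- k)) = infsum f UNIV"
  by (rule infsum_reindex_bij_betw[OF bij_minus_int])

text \<open>Absolute convergence justifies all termwise operations below.\<close>

context
  fixes a :: "int \<Rightarrow> complex"
  assumes a: "(\<lambda>k. norm (a k)) summable_on UNIV"
begin

lemma summable_trig_series: "(\<lambda>k. a k * cis (of_int k * x)) summable_on UNIV"
  by (rule abs_summable_summable) (use a in \<open>simp add: norm_mult\<close>)

lemma norm_trig_series_le: "norm (trig_series a x) \<le> (\<Sum>\<^sub>\<infinity>k. norm (a k))"
  unfolding trig_series_def
  by (rule norm_infsum_le[OF has_sum_infsum[OF summable_trig_series] has_sum_infsum[OF a]])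
    (simp add: norm_mult)

lemma has_integral_trig_series:
  "((\<lambda>x. trig_series a x * cis (c * x)) has_integral
     (\<Sum>\<^sub>\<infinity>k. integral {p..q} (\<lambda>x. a k * cis ((of_int k + c) * x)))) {p..q}"
proof -
  have "trig_series a x * cis (c * x) = (\<Sum>\<^sub>\<infinity>k. a k * cis ((of_int k + c) * x))" for x
    unfolding trig_series_def infsum_cmult_left'[symmetric]
    by (simp add: cis_mult distrib_right mult.assoc)
  then show ?thesis
    using has_integral_infsum[of p q "\<lambda>k x. a k * cis ((of_int k + c) * x)" "\<lambda>k. norm (a k)"] a
    by (simp add: norm_mult continuous_intros)
qed

lemma continuous_on_trig_series: "continuous_on {p..q} (trig_series a)"
  unfolding trig_series_def[abs_def]
  by (rule continuous_on_infsum[OF _ _ a]) (auto simp: norm_mult intro!: continuous_intros)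

lemma trig_series_real: "hermitian a \<Longrightarrow> complex_of_real (Re (trig_series a x)) = trig_series a x"
proof -
  assume h: "hermitian a"
  have "cnj (trig_series a x) = (\<Sum>\<^sub>\<infinity>k. a (- k) * cis (of_int (- k) * x))"
    using h by (simp add: trig_series_def hermitian_def cis_cnj flip: infsum_cnj)
  also have "\<dots> = trig_series a x"
    unfolding trig_series_def by (rule infsum_minus_int)
  finally show ?thesis by (simp add: complex_eq_iff)
qed

end

lemma integral_cis_int:
  "integral {-pi..pi} (\<lambda>x. cis (of_int j * x)) = (if j = 0 then 2 * pi else 0)"
proof (cases "j = 0")
  case False
  have "((\<lambda>x. cis (of_int j * x)) has_integral
      cis (of_int j * pi) / (\<i> * of_int j) - cis (of_int j * (- pi)) / (\<i> * of_int j)) {-pi..pi}"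
  proof (rule fundamental_theorem_of_calculus)
    fix x :: real
    have "((\<lambda>z. exp (\<i> * of_int j * z) / (\<i> * of_int j)) has_field_derivative
        exp (\<i> * of_int j * of_real x)) (at (of_real x))"
      using False by (auto intro!: derivative_eq_intros)
    from has_vector_derivative_real_field[OF this]
    show "((\<lambda>x. cis (of_int j * x) / (\<i> * of_int j)) has_vector_derivative cis (of_int j * x)) (at x within {-pi..pi})"
      by (simp add: cis_conv_exp mult_ac)
  qed simp
  moreover have "cis (of_int j * pi) = cis (of_int j * (- pi))"
    by (simp add: complex_eq_iff mult.commute[of _ pi])
  ultimately show ?thesis using False by (simp add: integral_unique)
qed (simp add: scaleR_conv_of_real)

lemma fourier_coeff_trig_series:
  assumes a: "(\<lambda>k. norm (a k)) summable_on UNIV" and h: "hermitian a"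
  shows "fourier_coeff (\<lambda>x. Re (trig_series a x)) k = a k"
proof -
  let ?g = "\<lambda>x. trig_series a x * cis (- of_int k * x)"
  have c: "continuous_on {-pi..pi} ?g"
    by (intro continuous_intros continuous_on_trig_series[OF a])
  have "fourier_coeff (\<lambda>x. Re (trig_series a x)) k = integral\<^sup>L (lebesgue_on {-pi..pi}) ?g / (2 * pi)"
    by (simp add: fourier_coeff_def trig_series_real[OF a h])
  also have "integral\<^sup>L (lebesgue_on {-pi..pi}) ?g = integral {-pi..pi} ?g"
    by (intro lebesgue_integral_eq_integral continuous_imp_integrable_real c) simp
  also have "\<dots> = (\<Sum>\<^sub>\<infinity>m. integral {-pi..pi} (\<lambda>x. a m * cis ((of_int m + - of_int k) * x)))"
    using has_integral_trig_series[OF a] by (rule integral_unique)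
  also have "\<dots> = (\<Sum>\<^sub>\<infinity>m. if m = k then a k * (2 * pi) else 0)"
  proof (rule infsum_cong)
    fix m
    have "integral {-pi..pi} (\<lambda>x. a m * cis ((of_int m + - of_int k) * x))
      = a m * integral {-pi..pi} (\<lambda>x. cis (of_int (m - k) * x))"
      by simp
    then show "integral {-pi..pi} (\<lambda>x. a m * cis ((of_int m + - of_int k) * x)) = (if m = k then a k * (2 * pi) else 0)"
      unfolding integral_cis_int by (auto simp: scaleR_conv_of_real)
  qed
  also have "\<dots> = a k * (2 * pi)"
    by (subst infsum_cong_neutral[where T = "{k}" and g = "\<lambda>m. if m = k then a k * (2 * pi) else 0"]) auto
  finally show ?thesis by simp
qed

lemma trig_series_mult:
  assumes a: "(\<lambda>k. norm (a k)) summable_on UNIV" and b: "(\<lambda>k. norm (b k)) summable_on UNIV"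
  shows "trig_series a x * trig_series b x = trig_series (conv a b) x"
proof -
  let ?f = "\<lambda>k l. (a (k - l) * cis (of_int (k - l) * x)) * (b l * cis (of_int l * x))"
  let ?A = "\<lambda>k. a k * cis (of_int k * x)" and ?B = "\<lambda>k. b k * cis (of_int k * x)"
  have n: "(\<lambda>p. norm ((\<lambda>(k, l). ?A k * ?B l) p)) summable_on UNIV"
    using summable_on_Times_nonneg(1)[OF a b] by (simp add: norm_mult case_prod_unfold)
  have s: "(\<lambda>(k, l). ?A k * ?B l) summable_on UNIV \<times> UNIV"
    using abs_summable_summable[OF n] by simp
  have eq: "(\<lambda>(k, l). ?f k l) = (\<lambda>p. (\<lambda>(k, l). ?A k * ?B l) ((\<lambda>(k, l). (k - l, l)) p))"
    by (auto simp: fun_eq_iff)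
  have s': "(\<lambda>(k, l). ?f k l) summable_on UNIV \<times> UNIV"
    using s unfolding eq UNIV_Times_UNIV summable_on_reindex_bij_betw[OF bij_shear] .
  have "trig_series a x * trig_series b x = (\<Sum>\<^sub>\<infinity>k. \<Sum>\<^sub>\<infinity>l. ?A k * ?B l)"
    unfolding trig_series_def infsum_cmult_right' infsum_cmult_left' ..
  also have "\<dots> = infsum (\<lambda>(k, l). ?A k * ?B l) UNIV"
    using infsum_Sigma_banach[OF s] by simp
  also have "\<dots> = infsum (\<lambda>(k, l). ?f k l) UNIV"
    unfolding eq by (rule infsum_reindex_bij_betw[OF bij_shear, symmetric])
  also have "\<dots> = (\<Sum>\<^sub>\<infinity>k. \<Sum>\<^sub>\<infinity>l. ?f k l)"
    using infsum_Sigma_banach[OF s'] by simp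
  also have "\<dots> = (\<Sum>\<^sub>\<infinity>k. \<Sum>\<^sub>\<infinity>l. (a (k - l) * b l) * cis (of_int k * x))"
  proof (intro infsum_cong)
    fix k l
    have "cis (of_int k * x) = cis (of_int (k - l) * x) * cis (of_int l * x)"
      by (simp add: cis_mult algebra_simps)
    then show "?f k l = (a (k - l) * b l) * cis (of_int k * x)" by simp
  qed
  also have "\<dots> = trig_series (conv a b) x"
    unfolding trig_series_def conv_def infsum_cmult_left' ..
  finally show ?thesis .
qed

text \<open>Termwise differentiation, as the converse of termwise integration of the differentiated
  series.\<close>

lemma trig_series_deriv:
  assumes a: "(\<lambda>k. norm (a k)) summable_on UNIV" and ka: "(\<lambda>k. bracket k * norm (a k)) summable_on UNIV"
  shows "deriv (\<lambda>x. Re (trig_series a x)) x = Re (trig_series (\<lambda>k. \<i> * of_int k * a k) x)"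
proof -
  let ?b = "\<lambda>k. \<i> * of_int k * a k"
  have b: "(\<lambda>k. norm (?b k)) summable_on UNIV"
    by (rule summable_on_comparison_test[OF ka])
      (auto simp: norm_mult intro!: mult_right_mono abs_le_bracket)
  define p q where "p = x - 1" and "q = x + 1"
  have I: "integral {p..u} (trig_series ?b) = trig_series a u - trig_series a p" if "p \<le> u" for u
  proof -
    have "integral {p..u} (\<lambda>y. ?b k * cis (of_int k * y)) = a k * cis (of_int k * u) - a k * cis (of_int k * p)" for k
    proof (intro integral_unique fundamental_theorem_of_calculus that)
      fix y
      have "((\<lambda>z. a k * exp (\<i> * of_int k * z)) has_field_derivative
        ?b k * exp (\<i> * of_int k * of_real y)) (at (of_real y))"
        by (auto intro!: derivative_eq_intros)
      from has_vector_derivative_real_field[OF this]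
      show "((\<lambda>y. a k * cis (of_int k * y)) has_vector_derivative ?b k * cis (of_int k * y)) (at y within {p..u})"
        by (simp add: cis_conv_exp mult_ac)
    qed
    then have "integral {p..u} (\<lambda>y. trig_series ?b y * cis (0 * y))
      = (\<Sum>\<^sub>\<infinity>k. a k * cis (of_int k * u) - a k * cis (of_int k * p))"
      using integral_unique[OF has_integral_trig_series[OF b, of 0 p u]] by simp
    also have "\<dots> = (\<Sum>\<^sub>\<infinity>k. a k * cis (of_int k * u) + - (a k * cis (of_int k * p)))" by simp
    also have "\<dots> = trig_series a u - trig_series a p"
      by (subst infsum_add) (auto simp: infsum_uminus trig_series_def summable_on_uminus intro!: summable_trig_series[OF a])
    finally show ?thesis by simp
  qed
  have x: "x \<in> {p..q}" "x \<in> {p<..<q}" by (auto simp: p_def q_def)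
  have "((\<lambda>u. integral {p..u} (trig_series ?b)) has_vector_derivative trig_series ?b x) (at x within {p..q})"
    by (intro integral_has_vector_derivative continuous_on_trig_series[OF b] x)
  then have "((\<lambda>u. trig_series a u - trig_series a p) has_vector_derivative trig_series ?b x) (at x within {p..q})"
    by (rule has_vector_derivative_transform[rotated 2]) (use I x in auto)
  then have "((\<lambda>u. (trig_series a u - trig_series a p) + trig_series a p) has_vector_derivative trig_series ?b x + 0) (at x within {p..q})"
    by (intro has_vector_derivative_add has_vector_derivative_const)
  then have "(trig_series a has_vector_derivative trig_series ?b x) (at x within {p..q})" by simp
  moreover have "at x within {p..q} = at x" using x(2) by (intro at_within_interior) simp
  ultimately have "(trig_series a has_vector_derivative trig_series ?b x) (at x)" by simp
  then have "((\<lambda>x. Re (trig_series a x)) has_vector_derivative Re (trig_series ?b x)) (at x)"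
    by (rule bounded_linear.has_vector_derivative[OF bounded_linear_Re])
  then show ?thesis
    by (intro DERIV_imp_deriv) (simp add: has_real_derivative_iff_has_vector_derivative)
qed

section \<open>Functions and their Fourier coefficients\<close>

text \<open>The part of membership in a Sobolev space that does not refer to Fourier coefficients.\<close>

definition periodic_L2 :: "(real \<Rightarrow> real) \<Rightarrow> bool" where
  "periodic_L2 f \<longleftrightarrow> (\<forall>x. f (x + 2 * pi) = f x) \<and>
     f \<in> borel_measurable (lebesgue_on {-pi..pi}) \<and>
     integrable (lebesgue_on {-pi..pi}) (\<lambda>x. (f x)\<^sup>2)"

lemma
  shows sobolev_space_iff: "f \<in> sobolev_space r \<longleftrightarrow> periodic_L2 f \<and> in_H r (fourier_coeff f)"
    and sobolev_norm_eq: "sobolev_norm r f = hnorm r (fourier_coeff f)"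
proof -
  have eq: "(bracket k ^ r * norm (fourier_coeff f k))\<^sup>2
    = (1 + (of_int k)\<^sup>2) ^ r * (norm (fourier_coeff f k))\<^sup>2" for k
    unfolding bracket_square[symmetric] power_mult_distrib
    by (simp only: power_mult[symmetric] mult.commute)
  show "f \<in> sobolev_space r \<longleftrightarrow> periodic_L2 f \<and> in_H r (fourier_coeff f)"
    "sobolev_norm r f = hnorm r (fourier_coeff f)"
    unfolding sobolev_space_def sobolev_norm_def in_H_def hnorm_def square_summable_def l2norm_def
      periodic_L2_def eq by auto
qed

lemma hermitian_fourier_coeff: "hermitian (fourier_coeff f)"
  unfolding hermitian_def fourier_coeff_def
  by (simp add: cis_cnj flip: Bochner_Integration.integral_cnj)

lemma periodic_L2_integrable:
  assumes "periodic_L2 f"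
  shows "integrable (lebesgue_on {-pi..pi}) (\<lambda>x. complex_of_real (f x) * cis (- (of_int k * x)))"
proof (rule Bochner_Integration.integrable_bound)
  show "integrable (lebesgue_on {-pi..pi}) (\<lambda>x. 1 + (f x)\<^sup>2)"
    using assms by (intro Bochner_Integration.integrable_add) (auto simp: periodic_L2_def)
  have "(\<lambda>x. cis (- of_int k * x)) \<in> borel_measurable (lebesgue_on {-pi..pi})"
    by (intro continuous_imp_measurable_on_sets_lebesgue continuous_intros) simp
  then show "(\<lambda>x. complex_of_real (f x) * cis (- (of_int k * x))) \<in> borel_measurable (lebesgue_on {-pi..pi})"
    using assms by (intro borel_measurable_times) (auto simp: periodic_L2_def)
  have "\<bar>y\<bar> \<le> 1 + y\<^sup>2" for y :: real
    using sum_squares_bound[of "\<bar>y\<bar>" 1] by (simp add: power2_eq_square)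
  then show "AE x in lebesgue_on {-pi..pi}. norm (complex_of_real (f x) * cis (- (of_int k * x))) \<le> norm (1 + (f x)\<^sup>2)"
    by (intro AE_I2) (simp add: norm_mult)
qed

lemma
  assumes f: "periodic_L2 f" and g: "periodic_L2 g"
  shows periodic_L2_lincomb: "periodic_L2 (\<lambda>x. f x + c * g x)"
    and fourier_coeff_lincomb: "fourier_coeff (\<lambda>x. f x + c * g x) k = fourier_coeff f k + c * fourier_coeff g k"
proof -
  have i: "integrable (lebesgue_on {-pi..pi}) (\<lambda>x. (f x + c * g x)\<^sup>2)"
  proof (rule Bochner_Integration.integrable_bound)
    show "integrable (lebesgue_on {-pi..pi}) (\<lambda>x. 2 * (f x)\<^sup>2 + 2 * c\<^sup>2 * (g x)\<^sup>2)"
      using f g by (intro Bochner_Integration.integrable_add integrable_mult_right) (auto simp: periodic_L2_def)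
    show "(\<lambda>x. (f x + c * g x)\<^sup>2) \<in> borel_measurable (lebesgue_on {-pi..pi})"
      using f g by (auto simp: periodic_L2_def)
    have "(a + b)\<^sup>2 \<le> 2 * a\<^sup>2 + 2 * b\<^sup>2" for a b :: real
      using sum_squares_bound[of a b] by (simp add: power2_eq_square algebra_simps)
    then have "(f x + c * g x)\<^sup>2 \<le> 2 * (f x)\<^sup>2 + 2 * c\<^sup>2 * (g x)\<^sup>2" for x
      by (metis power_mult_distrib mult.assoc)
    then show "AE x in lebesgue_on {-pi..pi}. norm ((f x + c * g x)\<^sup>2) \<le> norm (2 * (f x)\<^sup>2 + 2 * c\<^sup>2 * (g x)\<^sup>2)"
      by (intro AE_I2) (simp add: abs_of_nonneg)
  qed
  then show "periodic_L2 (\<lambda>x. f x + c * g x)"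
    using f g by (auto simp: periodic_L2_def)
  show "fourier_coeff (\<lambda>x. f x + c * g x) k = fourier_coeff f k + c * fourier_coeff g k"
    using periodic_L2_integrable[OF f, of k] periodic_L2_integrable[OF g, of k]
    by (simp add: fourier_coeff_def distrib_right add_divide_distrib mult.assoc)
qed

lemma periodic_L2_trig_series:
  assumes a: "(\<lambda>k. norm (a k)) summable_on UNIV"
  shows "periodic_L2 (\<lambda>x. Re (trig_series a x))"
proof -
  have c: "continuous_on {-pi..pi} (\<lambda>x. Re (trig_series a x))"
    by (intro continuous_intros continuous_on_trig_series[OF a])
  have "cis (of_int k * (x + 2 * pi)) = cis (of_int k * x)" for k x
  proof -
    have "cis (of_int k * (x + 2 * pi)) = cis (of_int k * x) * cis (2 * pi * of_int k)"
      by (simp add: cis_mult algebra_simps)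
    then show ?thesis by simp
  qed
  then have "trig_series a (x + 2 * pi) = trig_series a x" for x by (simp add: trig_series_def)
  then show ?thesis
    unfolding periodic_L2_def
    by (auto intro!: continuous_imp_measurable_on_sets_lebesgue continuous_imp_integrable_real
        continuous_intros c)
qed

lemma norm_fourier_coeff_le:
  assumes "\<And>x. \<bar>f x\<bar> \<le> C"
  shows "norm (fourier_coeff f k) \<le> C"
proof -
  have C: "0 \<le> C" using assms[of 0] by linarith
  let ?g = "\<lambda>x. complex_of_real (f x) * cis (- (of_int k * x))"
  have "norm (integral\<^sup>L (lebesgue_on {-pi..pi}) ?g) \<le> C * (2 * pi)"
  proof (cases "integrable (lebesgue_on {-pi..pi}) ?g")
    case True
    have "norm (integral\<^sup>L (lebesgue_on {-pi..pi}) ?g) \<le> (\<integral>x. C \<partial>(lebesgue_on {-pi..pi}))"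
      by (rule Bochner_Integration.integral_norm_bound_integral[OF True]) (use assms in \<open>auto simp: norm_mult\<close>)
    then show ?thesis by (simp add: measure_restrict_space mult_ac)
  qed (use C in \<open>simp add: not_integrable_integral_eq\<close>)
  then show ?thesis
    by (simp add: fourier_coeff_def norm_divide divide_le_eq norm_mult)
qed

section \<open>The equation and the scheme in Fourier variables\<close>

lemma airy_group_eq:
  "airy_group s f x = Re (trig_series (\<lambda>k. cis (- (s * of_int k ^ 3)) * fourier_coeff f k) x)"
  by (simp add: airy_group_def fourier_multiplier_eq)

lemma hermitian_airy: "hermitian a \<Longrightarrow> hermitian (\<lambda>k. cis (- (s * of_int k ^ 3)) * a k)"
  by (simp add: hermitian_def cis_cnj power3_eq_cube)

lemma hermitian_bilinear:
  assumes "\<And>k l. p (- k) (- l) = cnj (p k l)" "hermitian a" "hermitian b"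
  shows "hermitian (\<lambda>k. \<Sum>\<^sub>\<infinity>l. p k l * (a (k - l) * b l))"
  unfolding hermitian_def
proof
  fix k
  have "(\<Sum>\<^sub>\<infinity>l. p (- k) l * (a (- k - l) * b l)) = (\<Sum>\<^sub>\<infinity>l. p (- k) (- l) * (a (- k - - l) * b (- l)))"
    by (rule infsum_minus_int[symmetric])
  also have "\<dots> = (\<Sum>\<^sub>\<infinity>l. cnj (p k l * (a (k - l) * b l)))"
  proof (rule infsum_cong)
    fix l
    have e: "- k - - l = - (k - l)" by simp
    have "a (- k - - l) = cnj (a (k - l))" "b (- l) = cnj (b l)"
      using assms(2,3) unfolding hermitian_def e by blast+
    then show "p (- k) (- l) * (a (- k - - l) * b (- l)) = cnj (p k l * (a (k - l) * b l))"
      by (simp add: assms(1))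
  qed
  finally show "(\<Sum>\<^sub>\<infinity>l. p (- k) l * (a (- k - l) * b l)) = cnj (\<Sum>\<^sub>\<infinity>l. p k l * (a (k - l) * b l))"
    by (simp only: infsum_cnj)
qed

lemma hermitian_conv: "hermitian a \<Longrightarrow> hermitian b \<Longrightarrow> hermitian (conv a b)"
  using hermitian_bilinear[of "\<lambda>_ _. 1" a b] by (simp add: conv_def[abs_def])

lemma hermitian_kdv_bilinear:
  "hermitian a \<Longrightarrow> hermitian b \<Longrightarrow> hermitian (kdv_bilinear s a b)"
  using hermitian_bilinear[of "phase s" a b, OF phase_minus]
  by (simp add: kdv_bilinear_def hermitian_def)

lemma hermitian_scheme_increment:
  "hermitian a \<Longrightarrow> hermitian b \<Longrightarrow> hermitian (scheme_increment t \<tau> a b)"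
  using hermitian_bilinear[of "\<lambda>k l. \<i> * of_int k / 2 * phase_integral t \<tau> k l" a b]
  by (simp add: scheme_increment_def[abs_def] phase_integral_minus)

lemma in_H_conv:
  fixes a b :: "int \<Rightarrow> complex"
  assumes "in_H (Suc r) a" "in_H (Suc r) b"
  shows "in_H (Suc r) (conv a b)"
proof -
  have A: "in_H (Suc r) (conv (\<lambda>k. norm (a k)) (\<lambda>k. norm (b k)))"
    using H_algebra(2)[of r "\<lambda>k. norm (a k)" "\<lambda>k. norm (b k)"] assms by simp
  note s = summable_cmod_products[OF assms]
  have "norm (conv a b k) \<le> conv (\<lambda>k. norm (a k)) (\<lambda>k. norm (b k)) k" for k
    unfolding conv_def
    by (rule norm_infsum_le[OF has_sum_infsum[OF abs_summable_summable] has_sum_infsum[OF s]])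
      (use s[of k] in \<open>simp_all add: norm_mult\<close>)
  then show ?thesis
    by (intro in_H_dominated[OF A, of _ _ 1]) (simp_all add: conv_nonneg mult_left_mono)
qed

lemma in_H_airy [simp]: "in_H r (\<lambda>k. cis (c k) * a k) \<longleftrightarrow> in_H r a"
  by (simp add: in_H_def norm_mult)

text \<open>The doubly negated \<open>- - s\<close> is the multiplier of \<open>airy_group (- s)\<close> as it unfolds.\<close>

lemma airy_conv:
  "cis (- (s * of_int k ^ 3)) *
     conv (\<lambda>k. cis (- (- s * of_int k ^ 3)) * a k) (\<lambda>k. cis (- (- s * of_int k ^ 3)) * b k) k
   = (\<Sum>\<^sub>\<infinity>l. phase s k l * (a (k - l) * b l))"
  unfolding conv_def infsum_cmult_right'[symmetric]
proof (rule infsum_cong)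
  fix l
  have "phase s k l = cis (- (s * of_int k ^ 3)) * (cis (- (- s * of_int (k - l) ^ 3)) * cis (- (- s * of_int l ^ 3)))"
    by (simp add: phase_def cis_mult power3_eq_cube algebra_simps)
  then show "cis (- (s * of_int k ^ 3)) *
      (cis (- (- s * of_int (k - l) ^ 3)) * a (k - l) * (cis (- (- s * of_int l ^ 3)) * b l)) =
      phase s k l * (a (k - l) * b l)" by simp
qed

lemma square_airy_group:
  fixes s :: real and f :: "real \<Rightarrow> real"
  assumes "in_H (Suc r) (fourier_coeff f)"
  defines "b \<equiv> \<lambda>k. cis (- (s * of_int k ^ 3)) * fourier_coeff f k"
  shows "(\<lambda>x. (airy_group s f x)\<^sup>2) = (\<lambda>x. Re (trig_series (conv b b) x))"
    and "in_H (Suc r) (conv b b)" "hermitian (conv b b)"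
proof -
  have b: "in_H (Suc r) b" "hermitian b"
    using assms hermitian_airy[OF hermitian_fourier_coeff] by (auto simp: b_def)
  note ab = H1_abs_summable(1)[OF b(1)]
  have "(airy_group s f x)\<^sup>2 = Re (trig_series (conv b b) x)" for x
  proof -
    have "trig_series (conv b b) x = complex_of_real ((Re (trig_series b x))\<^sup>2)"
      by (simp add: trig_series_mult[OF ab ab, symmetric] power2_eq_square trig_series_real[OF ab b(2)])
    then show ?thesis by (simp add: airy_group_eq b_def)
  qed
  then show "(\<lambda>x. (airy_group s f x)\<^sup>2) = (\<lambda>x. Re (trig_series (conv b b) x))" by auto
  show "in_H (Suc r) (conv b b)" "hermitian (conv b b)"
    using b by (auto intro: in_H_conv hermitian_conv)
qed

text \<open>For \<open>w\<close> in \<open>H\<^sup>3\<close> all series in the nested definition converge absolutely, also after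
  differentiation, so each operation acts on the coefficients as expected.\<close>

lemma kdv_nonlinearity_eq:
  assumes "in_H 3 (fourier_coeff w)"
  shows "kdv_nonlinearity s w x
    = Re (trig_series (\<lambda>k. 2 * kdv_bilinear s (fourier_coeff w) (fourier_coeff w) k) x)"
proof -
  define b where "b = (\<lambda>k. cis (- (- s * of_int k ^ 3)) * fourier_coeff w k)"
  have 3: "in_H (Suc 2) (fourier_coeff w)" using assms by (simp add: numeral_3_eq_3 numeral_2_eq_2)
  note S = square_airy_group[OF 3, where s = "- s", folded b_def]
  have H2: "in_H (Suc 1) (conv b b)" using in_H_le[OF S(2), of "Suc 1"] by simp
  have ab: "(\<lambda>k. norm (conv b b k)) summable_on UNIV"
    and kab: "(\<lambda>k. bracket k * norm (conv b b k)) summable_on UNIV"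
    using H1_abs_summable(1)[OF S(2)] H1_summable[OF H2] by simp_all
  have "deriv (\<lambda>x. (airy_group (- s) w x)\<^sup>2) = (\<lambda>x. Re (trig_series (\<lambda>k. \<i> * of_int k * conv b b k) x))"
    unfolding S(1) by (rule ext) (rule trig_series_deriv[OF ab kab])
  moreover have "(\<lambda>k. norm (\<i> * of_int k * conv b b k)) summable_on UNIV"
    by (rule summable_on_comparison_test[OF kab])
      (auto simp: norm_mult intro!: mult_right_mono abs_le_bracket)
  moreover have "hermitian (\<lambda>k. \<i> * of_int k * conv b b k)"
    using S(3) by (simp add: hermitian_def)
  ultimately have "kdv_nonlinearity s w x
    = Re (trig_series (\<lambda>k. cis (- (s * of_int k ^ 3)) * (\<i> * of_int k * conv b b k)) x)"
    by (simp add: kdv_nonlinearity_def airy_group_eq[of s] fourier_coeff_trig_series)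
  also have "(\<lambda>k. cis (- (s * of_int k ^ 3)) * (\<i> * of_int k * conv b b k))
    = (\<lambda>k. \<i> * of_int k * (cis (- (s * of_int k ^ 3)) * conv b b k))" by auto
  also have "\<dots> = (\<lambda>k. 2 * kdv_bilinear s (fourier_coeff w) (fourier_coeff w) k)"
    unfolding b_def airy_conv kdv_bilinear_def by auto
  finally show ?thesis .
qed

lemma airy_square_airy:
  fixes s :: real and g :: "real \<Rightarrow> real"
  assumes "in_H 1 (fourier_coeff g)"
  defines "c \<equiv> \<lambda>k. \<Sum>\<^sub>\<infinity>l. phase s k l * (fourier_coeff g (k - l) * fourier_coeff g l)"
  shows "airy_group s (\<lambda>y. (airy_group (- s) g y)\<^sup>2) x = Re (trig_series c x)"
    and "(\<lambda>k. norm (c k)) summable_on UNIV"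
proof -
  define b where "b = (\<lambda>k. cis (- (- s * of_int k ^ 3)) * fourier_coeff g k)"
  have 1: "in_H (Suc 0) (fourier_coeff g)" using assms by simp
  note S = square_airy_group[OF 1, where s = "- s", folded b_def]
  note ab = H1_abs_summable(1)[OF S(2)]
  have c: "c = (\<lambda>k. cis (- (s * of_int k ^ 3)) * conv b b k)"
    unfolding c_def b_def airy_conv ..
  show "airy_group s (\<lambda>y. (airy_group (- s) g y)\<^sup>2) x = Re (trig_series c x)"
    unfolding S(1) by (simp add: airy_group_eq fourier_coeff_trig_series[OF ab S(3)] c)
  show "(\<lambda>k. norm (c k)) summable_on UNIV" using ab by (simp add: c norm_mult)
qed

text \<open>The denominators of \<open>b\<close> are those produced by integrating the phase.  On the frequencies where
  the phase is constant both sides vanish: for \<open>k = 0\<close> the phases at the two end points agree, and for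
  \<open>l = 0\<close> or \<open>l = k\<close> a zero mode occurs.\<close>

lemma scheme_increment_eq_phase_difference:
  assumes "a 0 = 0" "0 \<le> \<tau>" and b: "b = (\<lambda>k. (if k = 0 then 0 else inverse (\<i> * of_int k)) * a k)"
    and s: "\<And>s. (\<lambda>l. phase s k l * (b (k - l) * b l)) summable_on UNIV"
  shows "scheme_increment t \<tau> a a k = 1 / 6 *
    ((\<Sum>\<^sub>\<infinity>l. phase (t + \<tau>) k l * (b (k - l) * b l)) - (\<Sum>\<^sub>\<infinity>l. phase t k l * (b (k - l) * b l)))"
proof -
  have "1 / 6 * ((\<Sum>\<^sub>\<infinity>l. phase (t + \<tau>) k l * (b (k - l) * b l)) - (\<Sum>\<^sub>\<infinity>l. phase t k l * (b (k - l) * b l)))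
    = 1 / 6 * (\<Sum>\<^sub>\<infinity>l. phase (t + \<tau>) k l * (b (k - l) * b l) + - (phase t k l * (b (k - l) * b l)))"
    by (subst infsum_add) (auto simp: infsum_uminus summable_on_uminus s)
  also have "\<dots> = (\<Sum>\<^sub>\<infinity>l. 1 / 6 * (phase (t + \<tau>) k l * (b (k - l) * b l) + - (phase t k l * (b (k - l) * b l))))"
    by (rule infsum_cmult_right'[symmetric])
  also have "\<dots> = scheme_increment t \<tau> a a k"
    unfolding scheme_increment_def
  proof (rule infsum_cong)
    fix l
    show "1 / 6 * (phase (t + \<tau>) k l * (b (k - l) * b l) + - (phase t k l * (b (k - l) * b l)))
      = \<i> * of_int k / 2 * phase_integral t \<tau> k l * (a (k - l) * a l)"
    proof (cases "k = 0 \<or> l = 0 \<or> k = l")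
      case True
      then show ?thesis using assms(1) by (auto simp: b phase_def)
    next
      case False
      then have nz: "k * l * (k - l) \<noteq> 0" by simp
      define K L N where "K = (of_int k :: complex)" and "L = (of_int l :: complex)" and "N = (of_int (k - l) :: complex)"
      have KLN: "K \<noteq> 0" "L \<noteq> 0" "N \<noteq> 0" using False by (auto simp: K_def L_def N_def)
      have bb: "b (k - l) * b l = inverse (\<i> * N) * inverse (\<i> * L) * (a (k - l) * a l)"
        using False by (simp add: b N_def L_def)
      have ph: "phase_integral t \<tau> k l = (phase (t + \<tau>) k l - phase t k l) / (- (3 * \<i> * (K * L * N)))"
        unfolding phase_integral_eq[OF nz assms(2)] by (simp add: K_def L_def N_def)
      show ?thesis
        unfolding bb ph K_def[symmetric] using KLN by (simp add: field_simps)
    qed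
  qed
  finally show ?thesis by simp
qed

lemma kdv_scheme_step:
  assumes w: "in_H 1 (fourier_coeff (kdv_scheme \<tau> v0 n))" "fourier_coeff (kdv_scheme \<tau> v0 n) 0 = 0"
    and \<tau>: "0 \<le> \<tau>"
  defines "d \<equiv> scheme_increment (real n * \<tau>) \<tau> (fourier_coeff (kdv_scheme \<tau> v0 n)) (fourier_coeff (kdv_scheme \<tau> v0 n))"
  shows "kdv_scheme \<tau> v0 (Suc n) x = kdv_scheme \<tau> v0 n x + Re (trig_series d x)"
proof -
  define t where "t = real n * \<tau>"
  define f where "f = kdv_scheme \<tau> v0 n"
  define a where "a = fourier_coeff f"
  define b where "b = (\<lambda>k. (if k = 0 then 0 else inverse (\<i> * of_int k)) * a k)"
  have a: "in_H 1 a" "a 0 = 0" "hermitian a" using w hermitian_fourier_coeff by (auto simp: a_def f_def)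
  have "norm (b k) \<le> norm (a k)" for k
  proof (cases "k = 0")
    case False
    then have "1 \<le> \<bar>of_int k :: real\<bar>" by (simp flip: of_int_abs)
    then have "inverse \<bar>of_int k :: real\<bar> \<le> 1" by (simp add: inverse_le_1_iff)
    then show ?thesis using False mult_right_mono[of "inverse \<bar>of_int k :: real\<bar>" 1 "norm (a k)"]
      by (simp add: b_def norm_mult norm_inverse)
  qed (simp add: b_def)
  then have b: "in_H 1 b"
    by (intro in_H_dominated[OF a(1), of _ _ 1]) (auto intro!: mult_left_mono)
  have hb: "hermitian b" using a(3) by (simp add: hermitian_def b_def)
  have gb: "fourier_coeff (inv_deriv f) = b"
  proof -
    have "inv_deriv f = (\<lambda>x. Re (trig_series b x))"
      unfolding inv_deriv_def fourier_multiplier_eq[abs_def] b_def a_def ..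
    then show ?thesis
      using fourier_coeff_trig_series[OF H1_abs_summable(1)[of 0 b] hb] b by auto
  qed
  define c where "c s k = (\<Sum>\<^sub>\<infinity>l. phase s k l * (b (k - l) * b l))" for s k
  note A = airy_square_airy[where g = "inv_deriv f", unfolded gb, OF b, folded c_def]
  have d: "d k = 1 / 6 * (c (t + \<tau>) k - c t k)" for k
    unfolding d_def c_def t_def[symmetric] f_def[symmetric] a_def[symmetric]
    by (rule scheme_increment_eq_phase_difference[OF a(2) \<tau> b_def])
      (use summable_kdv_bilinear[of 0 b b] b in simp)
  have "trig_series d x = (\<Sum>\<^sub>\<infinity>k. 1 / 6 * (c (t + \<tau>) k * cis (of_int k * x) + - (c t k * cis (of_int k * x))))"
    unfolding trig_series_def d by (simp add: algebra_simps)
  also have "\<dots> = 1 / 6 * (trig_series (c (t + \<tau>)) x - trig_series (c t) x)"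
    unfolding infsum_cmult_right'
    by (subst infsum_add) (auto simp: trig_series_def infsum_uminus summable_on_uminus
        intro!: summable_trig_series A(2))
  finally have "6 * trig_series d x = trig_series (c (t + \<tau>)) x - trig_series (c t) x" by (simp add: mult.commute)
  then have "Re (6 * trig_series d x) = Re (trig_series (c (t + \<tau>)) x - trig_series (c t) x)"
    by (rule arg_cong)
  then have "Re (trig_series d x) = 1 / 6 * (Re (trig_series (c (t + \<tau>)) x) - Re (trig_series (c t) x))"
    by simp
  then show ?thesis
    unfolding kdv_scheme.simps Let_def t_def[symmetric] f_def[symmetric] A(1) by simp
qed

lemma kdv_scheme_coefficients:
  assumes "periodic_L2 v0" "in_H 1 (fourier_coeff v0)" "fourier_coeff v0 0 = 0" "0 \<le> \<tau>"
  shows "periodic_L2 (kdv_scheme \<tau> v0 n) \<and> in_H 1 (fourier_coeff (kdv_scheme \<tau> v0 n)) \<and>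
    fourier_coeff (kdv_scheme \<tau> v0 n) 0 = 0 \<and>
    (\<forall>k. fourier_coeff (kdv_scheme \<tau> v0 (Suc n)) k = fourier_coeff (kdv_scheme \<tau> v0 n) k
       + scheme_increment (real n * \<tau>) \<tau> (fourier_coeff (kdv_scheme \<tau> v0 n)) (fourier_coeff (kdv_scheme \<tau> v0 n)) k)"
proof -
  define W where "W n = fourier_coeff (kdv_scheme \<tau> v0 n)" for n
  define d where "d n = scheme_increment (real n * \<tau>) \<tau> (W n) (W n)" for n
  have step: "periodic_L2 (kdv_scheme \<tau> v0 (Suc n)) \<and> in_H 1 (W (Suc n)) \<and> W (Suc n) 0 = 0 \<and>
      (\<forall>k. W (Suc n) k = W n k + d n k)"
    if I: "periodic_L2 (kdv_scheme \<tau> v0 n)" "in_H 1 (W n)" "W n 0 = 0" for n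
  proof -
    have dH: "in_H 1 (d n)" unfolding d_def by (rule in_H_scheme_increment[OF I(2,3,2,3) assms(4)])
    have ds: "(\<lambda>k. norm (d n k)) summable_on UNIV" using H1_abs_summable(1)[of 0 "d n"] dH by simp
    have dh: "hermitian (d n)" unfolding d_def W_def by (intro hermitian_scheme_increment hermitian_fourier_coeff)
    have eq: "kdv_scheme \<tau> v0 (Suc n) = (\<lambda>x. kdv_scheme \<tau> v0 n x + 1 * Re (trig_series (d n) x))"
      using kdv_scheme_step[of \<tau> v0 n] I assms(4) unfolding d_def W_def by (simp add: fun_eq_iff del: kdv_scheme.simps)
    note L = periodic_L2_lincomb[OF I(1) periodic_L2_trig_series[OF ds], of 1]
      fourier_coeff_lincomb[OF I(1) periodic_L2_trig_series[OF ds], of 1]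
    have k: "W (Suc n) k = W n k + d n k" for k
      unfolding W_def eq L(2) by (simp add: fourier_coeff_trig_series[OF ds dh])
    then have "W (Suc n) = (\<lambda>k. W n k + d n k)" by auto
    then have "in_H 1 (W (Suc n))" using in_H_add[OF I(2) dH] by simp
    then show ?thesis using L(1) k I(3) by (simp add: eq d_def del: kdv_scheme.simps)
  qed
  have "periodic_L2 (kdv_scheme \<tau> v0 n) \<and> in_H 1 (W n) \<and> W n 0 = 0"
  proof (induction n)
    case 0
    then show ?case using assms by (simp add: W_def)
  next
    case (Suc n)
    then show ?case using step[of n] by blast
  qed
  with step[of n] show ?thesis by (simp add: W_def d_def del: kdv_scheme.simps)
qed

section \<open>The solution in Fourier variables\<close>

lemma summable_inverse_bracket_square: "(\<lambda>k. inverse ((bracket k)\<^sup>2)) summable_on UNIV"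
  using square_summable_inverse_bracket by (simp add: square_summable_def power_inverse)

lemma continuous_on_kdv_bilinear:
  assumes c: "\<And>k. continuous_on {p..q} (\<lambda>s. V s k)"
    and H: "\<And>s. s \<in> {p..q} \<Longrightarrow> in_H 3 (V s)" "\<And>s. s \<in> {p..q} \<Longrightarrow> hnorm 3 (V s) \<le> M"
  shows "continuous_on {p..q} (\<lambda>s. kdv_bilinear s (V s) (V s) k)"
  unfolding kdv_bilinear_def
proof (intro continuous_on_mult_left continuous_on_infsum)
  show "continuous_on {p..q} (\<lambda>s. phase s k l * (V s (k - l) * V s l))" for l
    by (intro continuous_intros c)
  show "(\<lambda>l. M * (M * inverse ((bracket l)\<^sup>2))) summable_on UNIV"
    by (intro summable_on_cmult_right summable_inverse_bracket_square)
  fix l s assume s: "s \<in> {p..q}"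
  have M: "0 \<le> M" using H(2)[OF s] hnorm_nonneg order_trans by blast
  have "bracket j ^ 3 * norm (V s j) \<le> M" for j
    using norm_le_hnorm[OF H(1)[OF s], of j] H(2)[OF s] by linarith
  then have "norm (V s j) \<le> M * inverse (bracket j ^ 3)" for j
    by (simp add: field_simps)
  moreover have "inverse (bracket j ^ 3) \<le> inverse ((bracket j)\<^sup>2)" "inverse (bracket j ^ 3) \<le> 1" for j
    by (auto intro!: le_imp_inverse_le power_increasing simp: inverse_le_1_iff one_le_power)
  ultimately have "norm (V s (k - l)) \<le> M * 1" "norm (V s l) \<le> M * inverse ((bracket l)\<^sup>2)"
    using M by (meson mult_left_mono order_trans)+
  then have "norm (V s (k - l)) * norm (V s l) \<le> M * 1 * (M * inverse ((bracket l)\<^sup>2))"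
    using M by (intro mult_mono) auto
  then show "norm (phase s k l * (V s (k - l) * V s l)) \<le> M * (M * inverse ((bracket l)\<^sup>2))"
    by (simp add: norm_mult)
qed

text \<open>The integral equation holds pointwise in \<open>x\<close> and has to be transferred to the coefficients.
  The nonlinearity is bounded uniformly in \<open>s\<close> and \<open>x\<close>, so \<open>v\<close> is Lipschitz in time uniformly in \<open>x\<close> and
  every coefficient is continuous in time.  Therefore the Fourier series of the nonlinearity has
  continuous terms, dominated by \<open>C / \<langle>k\<rangle>\<^sup>2\<close>, and can be integrated termwise; the resulting
  trigonometric series for \<open>v t - v r\<close> converges absolutely, so that its coefficients can be read off.\<close>

lemma kdv_solution_coefficients:
  assumes sol: "twisted_kdv_solution T v0 v"
    and H: "\<And>s. s \<in> {0..T} \<Longrightarrow> v s \<in> sobolev_space 3"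
      "\<And>s. s \<in> {0..T} \<Longrightarrow> hnorm 3 (fourier_coeff (v s)) \<le> M"
    and rs: "0 \<le> r" "r \<le> t" "t \<le> T"
  defines "V \<equiv> \<lambda>s. fourier_coeff (v s)"
  shows "((\<lambda>s. kdv_bilinear s (V s) (V s) k) has_integral V t k - V r k) {r..t}"
proof -
  let ?N = "\<lambda>s x. kdv_nonlinearity s (v s) x"
  let ?B = "\<lambda>s. kdv_bilinear s (V s) (V s)"
  have HV: "in_H 3 (V s)" "hnorm 3 (V s) \<le> M" if "s \<in> {0..T}" for s
    using H[OF that] by (auto simp: V_def sobolev_space_iff)
  define C where "C = 8 * kappa * M\<^sup>2"
  note B = kdv_bilinear_bounds[OF HV, folded C_def]
  have C: "0 \<le> C" by (simp add: C_def)
  have Bpt: "norm (?B s k) \<le> C * inverse ((bracket k)\<^sup>2)" if "s \<in> {0..T}" for s k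
  proof -
    have "(bracket k)\<^sup>2 * norm (?B s k) \<le> C"
      using norm_le_hnorm[OF B(1)[OF that that]] B(2)[OF that that] order_trans by blast
    then show ?thesis by (simp add: field_simps)
  qed
  have sB: "(\<lambda>k. norm (?B s k)) summable_on UNIV" if "s \<in> {0..T}" for s
    using H1_abs_summable(1)[of 1 "?B s"] B(1)[OF that that] by (simp add: numeral_2_eq_2)
  have N: "?N s x = 2 * Re (trig_series (?B s) x)" if "s \<in> {0..T}" for s x
    using kdv_nonlinearity_eq[of "v s" s x] HV(1)[OF that]
    by (simp add: V_def trig_series_def mult.assoc infsum_cmult_right')
  define D where "D = 2 * (kappa * C)"
  have D: "0 \<le> D" by (simp add: D_def C)
  have Nle: "\<bar>?N s x\<bar> \<le> D" if "s \<in> {0..T}" for s x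
  proof -
    have "norm (trig_series (?B s) x) \<le> kappa * hnorm 2 (?B s)"
      using norm_trig_series_le[OF sB[OF that], of x] H1_abs_summable(2)[of 1 "?B s"] B(1)[OF that that]
      by (simp add: numeral_2_eq_2)
    also have "\<dots> \<le> kappa * C" using B(2)[OF that that] by (intro mult_left_mono) auto
    finally show ?thesis
      using abs_Re_le_cmod[of "trig_series (?B s) x"] by (simp add: N[OF that] abs_mult D_def)
  qed
  have int: "((\<lambda>s. ?N s x) has_integral 2 * (v t x - v r x)) {r..t}"
    if rt: "0 \<le> r" "r \<le> t" "t \<le> T" for r t x
  proof -
    have i: "(\<lambda>s. ?N s x) integrable_on {0..q}" "integral {0..q} (\<lambda>s. ?N s x) = 2 * (v q x - v0 x)"
      if "q \<in> {0..T}" for q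
      using sol that unfolding twisted_kdv_solution_def by auto
    have t: "t \<in> {0..T}" "r \<in> {0..T}" using rt by auto
    have "(\<lambda>s. ?N s x) integrable_on {r..t}"
      by (rule integrable_subinterval_real[OF i(1)[OF t(1)]]) (use rt in auto)
    moreover have "integral {0..r} (\<lambda>s. ?N s x) + integral {r..t} (\<lambda>s. ?N s x) = integral {0..t} (\<lambda>s. ?N s x)"
      by (rule Henstock_Kurzweil_Integration.integral_combine[OF rt(1,2) i(1)[OF t(1)]])
    ultimately show ?thesis using i(2)[OF t(1)] i(2)[OF t(2)] by (simp add: has_integral_iff algebra_simps)
  qed
  have per: "periodic_L2 (v s)" if "s \<in> {0..T}" for s
    using H(1)[OF that] by (simp add: sobolev_space_iff)
  have cont: "continuous_on {0..T} (\<lambda>s. V s k)" for k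
  proof -
    have "norm (V t k - V r k) \<le> D / 2 * (t - r)" if rt: "0 \<le> r" "r \<le> t" "t \<le> T" for r t
    proof -
      have "\<bar>v t x + - 1 * v r x\<bar> \<le> D / 2 * (t - r)" for x
      proof -
        have "norm (2 * (v t x - v r x)) \<le> D * measure lborel {r..t}"
          by (rule has_integral_bound_real[OF D finite.emptyI int[OF rt, of x]]) (use Nle rt in auto)
        moreover have "norm (2 * (v t x - v r x)) = 2 * \<bar>v t x + - 1 * v r x\<bar>"
          by (simp only: real_norm_def abs_mult) simp
        ultimately show ?thesis using rt by simp
      qed
      then have "norm (fourier_coeff (\<lambda>x. v t x + - 1 * v r x) k) \<le> D / 2 * (t - r)"
        by (rule norm_fourier_coeff_le)
      then show ?thesis
        using fourier_coeff_lincomb[OF per per, of t r "- 1" k] rt by (simp add: V_def)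
    qed
    then have "(D / 2)-lipschitz_on {0..T} (\<lambda>s. V s k)"
    proof (intro lipschitz_onI)
      fix r t assume *: "r \<in> {0..T}" "t \<in> {0..T}"
        and le: "\<And>r t. 0 \<le> r \<Longrightarrow> r \<le> t \<Longrightarrow> t \<le> T \<Longrightarrow> norm (V t k - V r k) \<le> D / 2 * (t - r)"
      show "dist (V r k) (V t k) \<le> D / 2 * dist r t"
        using * le[of r t] le[of t r] by (cases "r \<le> t") (auto simp: dist_norm norm_minus_commute)
    qed (use D in auto)
    then show ?thesis by (rule lipschitz_on_continuous_on)
  qed
  have cB: "continuous_on {r..t} (\<lambda>s. ?B s k)" for k
    by (rule continuous_on_subset[OF continuous_on_kdv_bilinear[OF cont HV]]) (use rs in auto)
  define J where "J k = integral {r..t} (\<lambda>s. ?B s k)" for k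
  have hJ: "((\<lambda>s. ?B s k) has_integral J k) {r..t}" for k
    unfolding J_def by (intro integrable_integral integrable_continuous_interval cB)
  have sub: "s \<in> {0..T}" if "s \<in> {r..t}" for s using that rs by auto
  have HJ: "in_H 2 J"
    by (rule in_H_integral[OF hJ rs(2) B(1) B(2) C]) (use sub in auto)
  have sJ: "(\<lambda>k. norm (J k)) summable_on UNIV"
    using H1_abs_summable(1)[of 1 J] HJ by (simp add: numeral_2_eq_2)
  have herm: "hermitian J"
  proof -
    have "hermitian (?B s)" for s
      unfolding V_def by (intro hermitian_kdv_bilinear hermitian_fourier_coeff)
    then show ?thesis unfolding hermitian_def J_def by (simp add: Henstock_Kurzweil_Integration.integral_cnj)
  qed
  have vt: "v t = (\<lambda>x. v r x + 1 * Re (trig_series J x))"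
  proof
    fix x
    have "((\<lambda>s. trig_series (?B s) x) has_integral (\<Sum>\<^sub>\<infinity>k. integral {r..t} (\<lambda>s. ?B s k * cis (of_int k * x)))) {r..t}"
      unfolding trig_series_def
      by (rule has_integral_infsum[where M = "\<lambda>k. C * inverse ((bracket k)\<^sup>2)"])
        (use Bpt sub in \<open>auto simp: norm_mult intro!: continuous_intros cB summable_on_cmult_right summable_inverse_bracket_square\<close>)
    then have "((\<lambda>s. trig_series (?B s) x) has_integral trig_series J x) {r..t}"
      by (simp add: trig_series_def J_def)
    from has_integral_linear[OF this bounded_linear_Re]
    have "((\<lambda>s. 2 * Re (trig_series (?B s) x)) has_integral 2 * Re (trig_series J x)) {r..t}"
      by (intro has_integral_mult_right) (simp add: o_def)
    then have "((\<lambda>s. ?N s x) has_integral 2 * Re (trig_series J x)) {r..t}"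
      by (rule has_integral_eq[rotated]) (use N sub in auto)
    from has_integral_unique[OF this int[OF rs]] show "v t x = v r x + 1 * Re (trig_series J x)" by simp
  qed
  have "V t k = V r k + J k"
    unfolding V_def vt
    by (subst fourier_coeff_lincomb[OF per periodic_L2_trig_series[OF sJ]])
      (use rs fourier_coeff_trig_series[OF sJ herm] in auto)
  then show ?thesis using hJ[of k] by simp
qed

section \<open>First-order convergence\<close>

theorem theorem2p7:
  "\<exists>c :: real \<Rightarrow> real \<Rightarrow> real.
     \<forall>(T :: real) (v0 :: real \<Rightarrow> real) (v :: real \<Rightarrow> real \<Rightarrow> real).
       T > 0 \<longrightarrow>
       twisted_kdv_solution T v0 v \<longrightarrow>
       (\<integral>x. v0 x \<partial>(lebesgue_on {-pi..pi})) = 0 \<longrightarrow>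
       (\<forall>t\<in>{0..T}. v t \<in> sobolev_space 3) \<longrightarrow>
       bdd_above ((\<lambda>t. sobolev_norm 3 (v t)) ` {0..T}) \<longrightarrow>
       (\<exists>\<tau>0>0. \<forall>\<tau>. 0 < \<tau> \<and> \<tau> \<le> \<tau>0 \<longrightarrow>
          (\<forall>n :: nat. real n * \<tau> \<le> T \<longrightarrow>
             (\<lambda>x. v (real n * \<tau>) x - kdv_scheme \<tau> v0 n x) \<in> sobolev_space 1 \<and>
             sobolev_norm 1 (\<lambda>x. v (real n * \<tau>) x - kdv_scheme \<tau> v0 n x)
               \<le> c (SUP t\<in>{0..real n * \<tau>}. sobolev_norm 3 (v t)) (real n * \<tau>) * \<tau>))"
proof (intro exI[of _ error_constant] allI impI)
  fix T :: real and v0 and v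
  assume T: "T > 0" and sol: "twisted_kdv_solution T v0 v"
    and mean: "(\<integral>x. v0 x \<partial>(lebesgue_on {-pi..pi})) = 0"
    and reg: "\<forall>t\<in>{0..T}. v t \<in> sobolev_space 3"
    and bdd: "bdd_above ((\<lambda>t. sobolev_norm 3 (v t)) ` {0..T})"
  define V where "V s = fourier_coeff (v s)" for s
  define m where "m t = (SUP s\<in>{0..t}. sobolev_norm 3 (v s))" for t
  have bddt: "bdd_above ((\<lambda>t. sobolev_norm 3 (v t)) ` {0..t})" if "t \<le> T" for t
    by (rule bdd_above_mono[OF bdd]) (use that in auto)
  have m: "hnorm 3 (V s) \<le> m t" if "s \<in> {0..t}" "t \<le> T" for s t
    unfolding V_def m_def sobolev_norm_eq[symmetric] using that by (intro cSUP_upper bddt)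
  have m0: "0 \<le> m t" if "0 \<le> t" "t \<le> T" for t
    using order_trans[OF hnorm_nonneg m[of 0 t]] that by simp
  have m_mono: "m t \<le> m T" if "0 \<le> t" "t \<le> T" for t
    unfolding m_def using that by (intro cSUP_subset_mono bdd) auto
  have v0: "v 0 = v0"
    using sol T unfolding twisted_kdv_solution_def by (auto simp: fun_eq_iff)
  have V0: "V 0 0 = 0"
    using mean by (simp add: V_def v0 fourier_coeff_def)
  have H: "in_H 3 (V s)" "periodic_L2 (v s)" if "s \<in> {0..T}" for s
    using reg that by (auto simp: V_def sobolev_space_iff)
  have eq: "((\<lambda>q. kdv_bilinear q (V q) (V q) k) has_integral V s k - V r k) {r..s}"
    if "0 \<le> r" "r \<le> s" "s \<le> T" for r s k
    unfolding V_def
    by (rule kdv_solution_coefficients[OF sol _ _ that, of "m T"])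
      (use reg m[of _ T] in \<open>auto simp: V_def\<close>)
  have Vmean: "V s 0 = 0" if "s \<in> {0..T}" for s
  proof -
    have "((\<lambda>q. 0) has_integral V s 0 - V 0 0) {0..s}"
      using eq[of 0 s 0] that by (simp add: kdv_bilinear_def)
    then have "V s 0 - V 0 0 = 0" by (simp only: has_integral_0_eq)
    then show ?thesis by (simp add: V0)
  qed
  define K where "K = error_constant (m T) T"
  have K: "0 \<le> K" unfolding K_def using m0[of T] T by (intro error_constant_nonneg) auto
  show "\<exists>\<tau>0>0. \<forall>\<tau>. 0 < \<tau> \<and> \<tau> \<le> \<tau>0 \<longrightarrow>
          (\<forall>n :: nat. real n * \<tau> \<le> T \<longrightarrow>
             (\<lambda>x. v (real n * \<tau>) x - kdv_scheme \<tau> v0 n x) \<in> sobolev_space 1 \<and>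
             sobolev_norm 1 (\<lambda>x. v (real n * \<tau>) x - kdv_scheme \<tau> v0 n x)
               \<le> error_constant (SUP t\<in>{0..real n * \<tau>}. sobolev_norm 3 (v t)) (real n * \<tau>) * \<tau>)"
  \<comment> \<open>This choice gives \<open>K * \<tau> \<le> sqrt \<tau> \<le> 1\<close>, the smallness used in \<open>scheme_convergence\<close>.  The constant
    \<open>K\<close> belongs to the whole interval and dominates the error constants of all earlier times.\<close>
  proof (intro exI[of _ "inverse ((1 + K)\<^sup>2)"] conjI allI impI)
    show "0 < inverse ((1 + K)\<^sup>2)" using K by simp
    fix \<tau> :: real and n :: nat
    assume \<tau>': "0 < \<tau> \<and> \<tau> \<le> inverse ((1 + K)\<^sup>2)" and n: "real n * \<tau> \<le> T"
    then have \<tau>: "0 < \<tau>" by simp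
    define t where "t = real n * \<tau>"
    have t: "0 \<le> t" "t \<le> T" "t \<in> {0..T}" using n \<tau> by (auto simp: t_def)
    have "sqrt \<tau> \<le> sqrt (inverse ((1 + K)\<^sup>2))" using \<tau>' by simp
    also have "\<dots> = inverse (1 + K)" using K by (simp add: real_sqrt_inverse)
    finally have sq: "(1 + K) * sqrt \<tau> \<le> 1" using K by (simp add: field_simps)
    have sq1: "K * sqrt \<tau> \<le> 1" "sqrt \<tau> \<le> 1"
    proof -
      have "0 \<le> K * sqrt \<tau>" "0 \<le> sqrt \<tau>" using K \<tau> by auto
      moreover have "sqrt \<tau> + K * sqrt \<tau> \<le> 1" using sq by (simp add: distrib_right)
      ultimately show "K * sqrt \<tau> \<le> 1" "sqrt \<tau> \<le> 1" by linarith+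
    qed
    have "K * \<tau> = K * sqrt \<tau> * sqrt \<tau>" using \<tau> by simp
    also have "\<dots> \<le> 1 * sqrt \<tau>" using sq1 \<tau> by (intro mult_right_mono) auto
    finally have small: "K * \<tau> \<le> sqrt \<tau>" by simp
    have "error_constant (m t) t * \<tau> \<le> K * \<tau>"
      unfolding K_def using t \<tau> m0 m_mono by (intro mult_right_mono error_constant_mono) auto
    then have small': "error_constant (m t) t * \<tau> \<le> 1" "error_constant (m t) t * \<tau> \<le> sqrt \<tau>"
      using small sq1 by linarith+
    define W where "W n = fourier_coeff (kdv_scheme \<tau> v0 n)" for n
    have T0: "0 \<in> {0..T}" using T by simp
    have S: "periodic_L2 (kdv_scheme \<tau> v0 n)"
      "W (Suc n) k = W n k + scheme_increment (real n * \<tau>) \<tau> (W n) (W n) k" for n k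
      using kdv_scheme_coefficients[of v0 \<tau> n] H(2)[OF T0] in_H_le[OF H(1)[OF T0], of 1] V0 \<tau>
      by (auto simp: W_def V_def v0)
    \<comment> \<open>the convergence result is applied on \<open>[0, t]\<close>, so that only the norms up to \<open>t\<close> enter\<close>
    have conv: "in_H 1 (\<lambda>k. V (real n * \<tau>) k - W n k) \<and>
        hnorm 1 (\<lambda>k. V (real n * \<tau>) k - W n k) \<le> error_constant (m t) (real n * \<tau>) * \<tau>"
    proof (rule scheme_convergence[where T = t])
      show "hermitian (V s)" for s unfolding V_def by (rule hermitian_fourier_coeff)
      show "W 0 = V 0" by (simp add: W_def V_def v0)
    qed (use t \<tau> m H Vmean eq S small' in \<open>auto simp: t_def\<close>)
    have F: "fourier_coeff (\<lambda>x. v t x - kdv_scheme \<tau> v0 n x) = (\<lambda>k. V t k - W n k)"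
      using fourier_coeff_lincomb[OF H(2)[OF t(3)] S(1), of "- 1"] by (auto simp: V_def W_def)
    have P: "periodic_L2 (\<lambda>x. v t x - kdv_scheme \<tau> v0 n x)"
      using periodic_L2_lincomb[OF H(2)[OF t(3)] S(1), of "- 1"] by simp
    show "(\<lambda>x. v (real n * \<tau>) x - kdv_scheme \<tau> v0 n x) \<in> sobolev_space 1"
      unfolding t_def[symmetric] sobolev_space_iff F using P conv by (simp add: t_def)
    show "sobolev_norm 1 (\<lambda>x. v (real n * \<tau>) x - kdv_scheme \<tau> v0 n x)
        \<le> error_constant (SUP t\<in>{0..real n * \<tau>}. sobolev_norm 3 (v t)) (real n * \<tau>) * \<tau>"
      unfolding t_def[symmetric] sobolev_norm_eq[of 1] F using conv by (simp add: t_def m_def)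
  qed
qed

end
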